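(* The following statements are equivalent for all cardinals $\kappa\leq\lambda$: (i) $\kappa$ is $\lambda$-ineffable. (ii) For all sufficiently large cardinals $\theta$ and every $\mathcal{P}_\kappa(\lambda)$-list $\vec d=\langle d_a\mid a\in\mathcal{P}_\kappa(\lambda)\rangle$, there is a small embedding $j:M\longrightarrow \mathrm{H}(\theta)$ for $\kappa$ and $\delta\in M\cap\kappa$ such that $j(\delta)=\lambda$, $\vec d\in\mathrm{ran}(j)$ and $j^{-1}[d_{j[\delta]}]\in M$.
   Context: $\mathrm{H}(\theta)$ is the set of all sets whose transitive closure has cardinality less than $\theta$. An elementary embedding $j:M\to N$ between transitive classes is non-trivial if there is an ordinal $\alpha\in M$ with $j(\alpha)>\alpha$; then $\mathrm{crit}(j)$ denotes the least such ordinal. Given cardinals $\kappa<\theta$, a non-trivial elementary embedding $j:M\to \mathrm{H}(\theta)$ is a small embedding for $\kappa$ if $M\in \mathrm{H}(\theta)$ is transitive and $j(\mathrm{crit}(j))=\kappa$. "For all sufficiently large cardinals $\theta$" means: there is an ordinal $\alpha\geq\kappa$ such that the statement holds for all cardinals $\theta>\alpha$. $\mathcal{P}_\kappa(\lambda)$ is the set of all subsets of $\lambda$ of cardinality less than $\kappa$. Given a set $A$, an $A$-list is a sequence $\langle d_a\mid a\in A\rangle$ with $d_a\subseteq a$ for all $a\in A$. A regular uncountable cardinal $\kappa$ is $\lambda$-ineffable, where $\lambda\geq\kappa$ is a cardinal, if for every $\mathcal{P}_\kappa(\lambda)$-list $\langle d_a\mid a\in\mathcal{P}_\kappa(\lambda)\rangle$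 there is a subset $D$ of $\lambda$ such that $\{a\in\mathcal{P}_\kappa(\lambda)\mid d_a=D\cap a\}$ is stationary in $\mathcal{P}_\kappa(\lambda)$. Here $j[\delta]=\{j(\gamma)\mid\gamma<\delta\}$ and $j^{-1}[\,\cdot\,]$ denotes the pointwise preimage. *)

theory Defs
  imports Main "HOL-Library.Equipollence" "HOL-Library.Countable_Set"
begin

section \<open>The set-theoretic universe\<close>

text \<open>
  A type of class \<open>zfc_universe\<close> is a universe of sets: \<open>elts x\<close> is the collection of all
  members of \<open>x\<close>, so that \<open>y \<in> elts x\<close> is the membership relation, and the
  axioms are those of ZFC. The schemes of Separation and Replacement range over arbitrary HOL
  predicates and functions. HOL sets over the type play the role of classes.
\<close>

class zfc_universe =
  fixes elts :: "'a \<Rightarrow> 'a set"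
  assumes extensionality: "elts x = elts y \<Longrightarrow> x = y"
    and foundation: "elts x \<noteq> {} \<Longrightarrow> \<exists>y\<in>elts x. elts y \<inter> elts x = {}"
    and pairing: "\<exists>z. elts z = {x, y}"
    and union: "\<exists>z. elts z = \<Union> (elts ` elts x)"
    and power_set: "\<exists>z. elts z = {y. elts y \<subseteq> elts x}"
    and infinity: "\<exists>z. (\<exists>e\<in>elts z. elts e = {}) \<and>
                       (\<forall>y\<in>elts z. \<exists>s\<in>elts z. elts s = insert y (elts y))"
    and separation: "\<exists>z. elts z = {y \<in> elts x. P y}"
    and replacement: "\<exists>z. elts z = F ` elts x"
    and choice: "(\<forall>y\<in>elts x. elts y \<noteq> {}) \<and>
                 (\<forall>y\<in>elts x. \<forall>y'\<in>elts x. y \<noteq> y' \<longrightarrow> elts y \<inter> elts y' = {}) \<Longrightarrow>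
                 \<exists>c. \<forall>y\<in>elts x. \<exists>!z. z \<in> elts y \<inter> elts c"

text \<open>The set with the given members; only meaningful if the collection is not a proper class.\<close>

definition vset :: "'v::zfc_universe set \<Rightarrow> 'v" where
  "vset A = (THE x. elts x = A)"

definition opair :: "'v::zfc_universe \<Rightarrow> 'v \<Rightarrow> 'v" where
  "opair a b = vset {vset {a}, vset {a, b}}"

definition fun_graph :: "'v::zfc_universe set \<Rightarrow> ('v \<Rightarrow> 'v) \<Rightarrow> 'v" where
  "fun_graph A f = vset ((\<lambda>a. opair a (f a)) ` A)"


section \<open>Ordinals and cardinals\<close>

definition transitive_class :: "'v::zfc_universe set \<Rightarrow> bool" where
  "transitive_class A \<longleftrightarrow> (\<forall>y\<in>A. elts y \<subseteq> A)"

text \<open>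
  Von Neumann ordinals. For ordinals, \<open>\<alpha> < \<beta>\<close> is \<open>\<alpha> \<in> elts \<beta>\<close> and
  \<open>\<alpha> \<le> \<beta>\<close> is \<open>elts \<alpha> \<subseteq> elts \<beta>\<close>.
\<close>

definition Ord :: "'v::zfc_universe \<Rightarrow> bool" where
  "Ord \<alpha> \<longleftrightarrow> transitive_class (elts \<alpha>) \<and> (\<forall>\<beta>\<in>elts \<alpha>. transitive_class (elts \<beta>))"

text \<open>Finite cardinals are included. By Replacement, every bijection between the members of two
  sets is represented by a set.\<close>

definition Card :: "'v::zfc_universe \<Rightarrow> bool" where
  "Card \<kappa> \<longleftrightarrow> Ord \<kappa> \<and> (\<forall>\<beta>\<in>elts \<kappa>. \<not> elts \<beta> \<approx> elts \<kappa>)"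

definition regular_cardinal :: "'v::zfc_universe \<Rightarrow> bool" where
  "regular_cardinal \<kappa> \<longleftrightarrow> Card \<kappa> \<and> infinite (elts \<kappa>) \<and>
     (\<forall>X. X \<subseteq> elts \<kappa> \<and> X \<prec> elts \<kappa> \<longrightarrow> (\<exists>\<beta>\<in>elts \<kappa>. X \<subseteq> elts \<beta>))"

definition tc :: "'v::zfc_universe \<Rightarrow> 'v set" where
  "tc x = \<Inter> {T. elts x \<subseteq> T \<and> transitive_class T}"

definition H :: "'v::zfc_universe \<Rightarrow> 'v set" where
  "H \<theta> = {x. tc x \<prec> elts \<theta>}"


section \<open>Elementary embeddings\<close>

text \<open>Formulas of the language of set theory with variables named by natural numbers.\<close>

datatype fm = Mem nat nat | Eq nat nat | Neg fm | Conj fm fm | Ex nat fm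

primrec sat :: "'v::zfc_universe set \<Rightarrow> fm \<Rightarrow> (nat \<Rightarrow> 'v) \<Rightarrow> bool" where
  "sat A (Mem m n) s \<longleftrightarrow> s m \<in> elts (s n)"
| "sat A (Eq m n) s \<longleftrightarrow> s m = s n"
| "sat A (Neg \<phi>) s \<longleftrightarrow> \<not> sat A \<phi> s"
| "sat A (Conj \<phi> \<psi>) s \<longleftrightarrow> sat A \<phi> s \<and> sat A \<psi> s"
| "sat A (Ex n \<phi>) s \<longleftrightarrow> (\<exists>x\<in>A. sat A \<phi> (s(n := x)))"

definition elementary_embedding ::
    "'v::zfc_universe set \<Rightarrow> 'v set \<Rightarrow> ('v \<Rightarrow> 'v) \<Rightarrow> bool" where
  "elementary_embedding M N j \<longleftrightarrow> j ` M \<subseteq> N \<and>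
     (\<forall>\<phi> s. range s \<subseteq> M \<longrightarrow> (sat M \<phi> s \<longleftrightarrow> sat N \<phi> (j \<circ> s)))"

definition nontrivial :: "'v::zfc_universe set \<Rightarrow> ('v \<Rightarrow> 'v) \<Rightarrow> bool" where
  "nontrivial M j \<longleftrightarrow> (\<exists>\<alpha>\<in>M. Ord \<alpha> \<and> \<alpha> \<in> elts (j \<alpha>))"

definition crit :: "'v::zfc_universe set \<Rightarrow> ('v \<Rightarrow> 'v) \<Rightarrow> 'v" where
  "crit M j = (THE \<alpha>. \<alpha> \<in> M \<and> Ord \<alpha> \<and> \<alpha> \<in> elts (j \<alpha>) \<and>
                 (\<forall>\<beta>\<in>M. Ord \<beta> \<and> \<beta> \<in> elts (j \<beta>) \<longrightarrow> elts \<alpha> \<subseteq> elts \<beta>))"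

definition small_embedding ::
    "'v::zfc_universe \<Rightarrow> 'v \<Rightarrow> 'v \<Rightarrow> ('v \<Rightarrow> 'v) \<Rightarrow> bool" where
  "small_embedding \<kappa> \<theta> M j \<longleftrightarrow>
     Card \<kappa> \<and> Card \<theta> \<and> \<kappa> \<in> elts \<theta> \<and>
     M \<in> H \<theta> \<and> transitive_class (elts M) \<and>
     elementary_embedding (elts M) (H \<theta>) j \<and> nontrivial (elts M) j \<and>
     j (crit (elts M) j) = \<kappa>"


section \<open>Ineffability\<close>

definition Pk :: "'v::zfc_universe \<Rightarrow> 'v \<Rightarrow> 'v set" where
  "Pk \<kappa> lam = {a. elts a \<subseteq> elts lam \<and> elts a \<prec> elts \<kappa>}"

definition unbounded_Pk :: "'v::zfc_universe \<Rightarrow> 'v \<Rightarrow> 'v set \<Rightarrow> bool" where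
  "unbounded_Pk \<kappa> lam C \<longleftrightarrow> (\<forall>a\<in>Pk \<kappa> lam. \<exists>c\<in>C. elts a \<subseteq> elts c)"

text \<open>Closure under unions of nonempty increasing sequences of length less than \<open>\<kappa>\<close>.\<close>

definition closed_Pk :: "'v::zfc_universe \<Rightarrow> 'v set \<Rightarrow> bool" where
  "closed_Pk \<kappa> C \<longleftrightarrow>
     (\<forall>\<beta>\<in>elts \<kappa>. \<forall>x. elts \<beta> \<noteq> {} \<and> x ` elts \<beta> \<subseteq> C \<and>
        (\<forall>\<eta>\<in>elts \<beta>. \<forall>\<xi>\<in>elts \<eta>. elts (x \<xi>) \<subseteq> elts (x \<eta>)) \<longrightarrow>
        vset (\<Union>\<xi>\<in>elts \<beta>. elts (x \<xi>)) \<in> C)"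

definition club_Pk :: "'v::zfc_universe \<Rightarrow> 'v \<Rightarrow> 'v set \<Rightarrow> bool" where
  "club_Pk \<kappa> lam C \<longleftrightarrow> C \<subseteq> Pk \<kappa> lam \<and> unbounded_Pk \<kappa> lam C \<and> closed_Pk \<kappa> C"

definition stationary_Pk :: "'v::zfc_universe \<Rightarrow> 'v \<Rightarrow> 'v set \<Rightarrow> bool" where
  "stationary_Pk \<kappa> lam S \<longleftrightarrow>
     S \<subseteq> Pk \<kappa> lam \<and> (\<forall>C. club_Pk \<kappa> lam C \<longrightarrow> S \<inter> C \<noteq> {})"

text \<open>An \<open>A\<close>-list is given by a HOL function, of which only the values on \<open>A\<close> matter; as an
  element of the universe it is \<open>fun_graph A d\<close>.\<close>

definition is_list :: "'v::zfc_universe set \<Rightarrow> ('v \<Rightarrow> 'v) \<Rightarrow> bool" where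
  "is_list A d \<longleftrightarrow> (\<forall>a\<in>A. elts (d a) \<subseteq> elts a)"

definition ineffable :: "'v::zfc_universe \<Rightarrow> 'v \<Rightarrow> bool" where
  "ineffable \<kappa> lam \<longleftrightarrow>
     regular_cardinal \<kappa> \<and> uncountable (elts \<kappa>) \<and> Card lam \<and> elts \<kappa> \<subseteq> elts lam \<and>
     (\<forall>d. is_list (Pk \<kappa> lam) d \<longrightarrow>
        (\<exists>D. elts D \<subseteq> elts lam \<and>
             stationary_Pk \<kappa> lam {a \<in> Pk \<kappa> lam. elts (d a) = elts D \<inter> elts a}))"

end

theory Submission
  imports Defs
begin

text \<open>
  From ineffability to small embeddings. Given a list \<open>d\<close>, let \<open>D\<close> be a subset of \<open>lam\<close> for which
  the set of all \<open>a\<close> with \<open>d a = D \<inter> a\<close> is stationary. The sets \<open>a\<close> that are the trace on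
  \<open>lam\<close> of their Skolem hull in \<open>H \<theta>\<close>, with \<open>a \<inter> \<kappa>\<close> an ordinal, form a club (\<open>club_hull_fixed\<close>),
  because hulls are finitary and \<open>\<kappa>\<close> is regular and uncountable. Collapsing the hull of an \<open>a\<close> that
  lies in both sets gives the embedding: its inverse collapse \<open>j\<close> sends the order type \<open>\<delta>\<close> of \<open>a\<close> to
  \<open>lam\<close> with \<open>j[\<delta>] = a\<close>, and the preimage of \<open>d a = D \<inter> a\<close> is the collapse of \<open>D\<close>
  (\<open>ineffable_imp_embedding\<close>).

  From small embeddings to ineffability. Let \<open>\<mu>\<close> be the critical point of \<open>j : M \<rightarrow> H \<theta>\<close>, with
  \<open>j \<mu> = \<kappa>\<close>. Two facts carry the argument. First, \<open>j c = j[c]\<close> whenever \<open>c\<close> has fewer than \<open>\<mu>\<close>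
  members in the sense of \<open>M\<close> (\<open>j_lt_card\<close>); this already yields that \<open>\<kappa>\<close> is regular. Second, a
  club in \<open>P_\<kappa>(lam)\<close> contains all unions of size less than \<open>\<kappa>\<close> of its directed subfamilies, however
  large these families are (\<open>closed_Pk_directed\<close>). Now let \<open>D = j(j^{-1}[d_{j[\<delta>]}])\<close>, so that
  \<open>d b = D \<inter> b\<close> holds for \<open>b = j[\<delta>]\<close>. If some club avoided the set of all \<open>b\<close> with this property,
  then \<open>M\<close> would contain a \<open>C0\<close> such that \<open>j C0\<close> avoids it, too. By the first fact, \<open>b\<close> is the union of the
  directed family \<open>j[C0]\<close>, which is part of \<open>j C0\<close>; by the second fact \<open>b\<close> is avoided, a contradiction
  (\<open>embedding_imp_stationary\<close>). What is reflected from \<open>H \<theta>\<close> to \<open>M\<close> is not that a club exists but the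
  consequence about directed unions (\<open>rel_avoids\<close>), which is easily written as a formula.

  Both directions rest on ordinals, cardinals, regularity, Mostowski collapses and Skolem hulls,
  which are developed from the axioms of the universe. The cardinal \<open>\<theta>\<close> is taken above the size of the
  third power set of \<open>lam\<close>.
\<close>


section \<open>Small classes\<close>

text \<open>HOL sets over the universe are classes. Calculations are done with them, and \<open>vset\<close> is
  applied only once a class is known to be the extension of a set.\<close>

definition small :: "'v::zfc_universe set \<Rightarrow> bool" where
  "small A \<longleftrightarrow> (\<exists>x. elts x = A)"

lemma small_elts [simp]: "small (elts x)"
  by (auto simp: small_def)

lemma elts_inject [simp]: "elts x = elts y \<longleftrightarrow> x = y"
  using extensionality by blast

lemma elts_vset [simp]: "small A \<Longrightarrow> elts (vset A) = A"
  unfolding small_def vset_def by (metis (mono_tags, lifting) extensionality theI)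

lemma vset_elts [simp]: "vset (elts x) = x"
  by (rule extensionality) (rule elts_vset[OF small_elts])

lemma small_subset:
  assumes "small B" "A \<subseteq> B"
  shows "small A"
proof -
  obtain x where x: "elts x = B" using assms by (auto simp: small_def)
  obtain z where "elts z = {y \<in> elts x. y \<in> A}" using separation[of x "\<lambda>y. y \<in> A"] by blast
  then show ?thesis using x assms(2) unfolding small_def by (intro exI[of _ z]) auto
qed

text \<open>Replacement along a surjection from a set. The index type is arbitrary, so that sequences over
  \<open>nat\<close> and families indexed by lists or pairs are covered as well.\<close>

lemma small_image_lepoll:
  fixes f :: "'i \<Rightarrow> 'v::zfc_universe" and x :: 'v
  assumes "I \<lesssim> elts x"
  shows "small (f ` I)"
proof (cases "I = {}")
  case True
  obtain z :: 'v where "elts z = {y \<in> elts undefined. False}"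
    using separation[of undefined "\<lambda>_. False"] by blast
  then have "elts z = f ` I" using True by auto
  then show ?thesis unfolding small_def by (rule exI)
next
  case False
  then obtain g where "I \<subseteq> g ` elts x" using assms by (auto simp: lepoll_iff)
  then have sub: "f ` I \<subseteq> (f \<circ> g) ` elts x" by auto
  obtain z where "elts z = (f \<circ> g) ` elts x" using replacement[where F="f \<circ> g" and x=x] by blast
  then have "small ((f \<circ> g) ` elts x)" by (auto simp: small_def)
  then show ?thesis using sub small_subset by blast
qed

lemma small_image [simp]:
  fixes f :: "'v \<Rightarrow> 'v::zfc_universe"
  shows "small A \<Longrightarrow> small (f ` A)"
  using small_image_lepoll[of A "vset A" f] by simp

lemma small_lepoll: "small (B::'v::zfc_universe set) \<Longrightarrow> A \<lesssim> B \<Longrightarrow> small (A::'v set)"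
  using small_image_lepoll[of A "vset B" id] by simp

lemma small_UN_lepoll:
  fixes B :: "'i \<Rightarrow> 'v::zfc_universe set" and x :: 'v
  assumes "I \<lesssim> elts x" "\<And>i. i \<in> I \<Longrightarrow> small (B i)"
  shows "small (\<Union>i\<in>I. B i)"
proof -
  obtain y where y: "elts y = (\<lambda>i. vset (B i)) ` I"
    using small_image_lepoll[OF assms(1), of "\<lambda>i. vset (B i)"] unfolding small_def by blast
  obtain z where "elts z = \<Union> (elts ` elts y)" using union by blast
  also have "\<dots> = (\<Union>i\<in>I. B i)" using assms(2) by (simp add: y image_image)
  finally show ?thesis unfolding small_def by (rule exI)
qed

lemma small_UN: "small (I::'v::zfc_universe set) \<Longrightarrow> (\<And>i. i \<in> I \<Longrightarrow> small (B i :: 'v set)) \<Longrightarrow> small (\<Union>i\<in>I. B i)"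
  using small_UN_lepoll[of I "vset I" B] by simp

lemma small_pair [simp]: "small {a, b}"
  using pairing[of a b] by (auto simp: small_def)

lemma small_singleton [simp]: "small {a}"
  using small_pair[of a a] by simp

lemma small_Un [simp]:
  assumes "small A" "small B"
  shows "small (A \<union> B)"
proof -
  have "A \<union> B = (\<Union>x\<in>{vset A, vset B}. elts x)" using assms by auto
  then show ?thesis using small_UN[of "{vset A, vset B}" elts] by simp
qed

lemma small_insert [simp]: "small A \<Longrightarrow> small (insert a A)"
  using small_Un[OF small_singleton, of A a] by simp

lemma small_empty [simp]: "small {}"
  by (rule small_subset[OF small_singleton]) auto

lemma small_finite: "finite A \<Longrightarrow> small A"
  by (induction rule: finite_induct) auto

definition powset :: "'v::zfc_universe \<Rightarrow> 'v" where
  "powset x = vset {y. elts y \<subseteq> elts x}"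

lemma elts_powset [simp]: "elts (powset x) = {y. elts y \<subseteq> elts x}"
  unfolding powset_def using power_set[of x] by (intro elts_vset) (auto simp: small_def)

lemma vset_pair_inject: "vset {a, b} = vset {c, d} \<longleftrightarrow> {a, b} = {c, d}"
  by (metis elts_vset small_pair)

lemma vset_singleton_inject: "vset {a} = vset {c, d} \<longleftrightarrow> a = c \<and> a = d"
    "vset {c, d} = vset {a} \<longleftrightarrow> a = c \<and> a = d"
    "vset {a} = vset {c} \<longleftrightarrow> a = c"
  using vset_pair_inject[of a a c d] vset_pair_inject[of a a c c] by auto

lemma opair_inject [simp]: "opair a b = opair c d \<longleftrightarrow> a = c \<and> b = d"
proof
  assume "opair a b = opair c d"
  then have "{vset {a, a}, vset {a, b}} = {vset {c, c}, vset {c, d}}"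
    by (simp add: opair_def vset_pair_inject)
  then show "a = c \<and> b = d"
    by (auto simp: doubleton_eq_iff vset_pair_inject vset_singleton_inject)
qed auto

lemma opair_iff_elts:
  "p = opair a b \<longleftrightarrow> (\<exists>u v. elts u = {a} \<and> elts v = {a, b} \<and> elts p = {u, v})"
proof
  assume "p = opair a b"
  then show "\<exists>u v. elts u = {a} \<and> elts v = {a, b} \<and> elts p = {u, v}"
    by (intro exI[of _ "vset {a}"] exI[of _ "vset {a, b}"]) (simp add: opair_def)
next
  assume "\<exists>u v. elts u = {a} \<and> elts v = {a, b} \<and> elts p = {u, v}"
  then obtain u v where "elts u = {a}" "elts v = {a, b}" "elts p = {u, v}" by blast
  then have "u = vset {a}" "v = vset {a, b}" "p = vset {u, v}"
    using vset_elts[of u] vset_elts[of v] vset_elts[of p] by simp_all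
  then show "p = opair a b" by (simp add: opair_def)
qed

lemma elts_fun_graph [simp]: "small A \<Longrightarrow> elts (fun_graph A f) = (\<lambda>a. opair a (f a)) ` A"
  by (simp add: fun_graph_def)

text \<open>The von Neumann numerals all lie in an inductive set. They thus inject \<open>nat\<close> into a set,
  which makes Replacement applicable to sequences.\<close>

primrec numeral_of :: "nat \<Rightarrow> 'v::zfc_universe" where
  "numeral_of 0 = vset {}"
| "numeral_of (Suc n) = vset (insert (numeral_of n) (elts (numeral_of n)))"

lemma mem_not_refl [simp]: "x \<notin> elts x"
  using foundation[of "vset {x}"] by auto

lemma elts_numeral_of: "elts (numeral_of n) = numeral_of ` {..<n}"
  by (induction n) (auto simp: lessThan_Suc small_finite)

lemma inj_numeral_of: "inj numeral_of"
proof (rule linorder_inj_onI')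
  fix i j :: nat assume "i < j"
  then have "numeral_of i \<in> elts (numeral_of j)" by (auto simp: elts_numeral_of)
  then show "numeral_of i \<noteq> numeral_of j" by (metis mem_not_refl)
qed

lemma nat_lepoll_set: "\<exists>z::'v::zfc_universe. (UNIV::nat set) \<lesssim> elts z"
proof -
  obtain z :: 'v where z: "\<exists>e\<in>elts z. elts e = {}"
    "\<And>y. y \<in> elts z \<Longrightarrow> \<exists>s\<in>elts z. elts s = insert y (elts y)"
    using infinity by metis
  have "numeral_of n \<in> elts z" for n
  proof (induction n)
    case 0
    then show ?case using z(1) by (metis numeral_of.simps(1) vset_elts)
  next
    case (Suc n)
    then show ?case using z(2) by (metis numeral_of.simps(2) vset_elts)
  qed
  then show ?thesis using inj_numeral_of unfolding lepoll_def by blast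
qed

lemma small_UN_nat: "(\<And>n::nat. small (B n :: 'v::zfc_universe set)) \<Longrightarrow> small (\<Union>n. B n)"
  using nat_lepoll_set small_UN_lepoll[of UNIV] by metis


section \<open>Transitive closure and recursion on membership\<close>

lemma transitive_classD: "transitive_class A \<Longrightarrow> y \<in> A \<Longrightarrow> z \<in> elts y \<Longrightarrow> z \<in> A"
  by (auto simp: transitive_class_def)

lemma elts_subset_tc: "elts x \<subseteq> tc x"
  by (auto simp: tc_def)

lemma transitive_class_tc: "transitive_class (tc x)"
  unfolding tc_def transitive_class_def by blast

lemma tc_least: "elts x \<subseteq> T \<Longrightarrow> transitive_class T \<Longrightarrow> tc x \<subseteq> T"
  by (auto simp: tc_def)

lemma tc_mono: "elts y \<subseteq> elts x \<Longrightarrow> tc y \<subseteq> tc x"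
  by (meson elts_subset_tc subset_trans tc_least transitive_class_tc)

lemma tc_mem: "y \<in> elts x \<Longrightarrow> tc y \<subseteq> tc x"
  by (meson elts_subset_tc subset_iff tc_least transitive_class_def transitive_class_tc)

text \<open>The transitive closure is the union of the iterated unions of \<open>x\<close>, a countable union of sets.\<close>

lemma small_tc: "small (tc x)"
proof -
  define U where "U n = ((\<lambda>A. \<Union>y\<in>A. elts y) ^^ n) (elts x)" for n
  have U: "small (U n)" for n
    unfolding U_def by (induction n) (auto intro: small_UN)
  have "transitive_class (\<Union>n. U n)"
    unfolding transitive_class_def
  proof (intro ballI subsetI)
    fix y z assume "y \<in> (\<Union>n. U n)" "z \<in> elts y"
    then obtain n where "y \<in> U n" by blast
    then have "z \<in> U (Suc n)" using \<open>z \<in> elts y\<close> by (auto simp: U_def)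
    then show "z \<in> (\<Union>n. U n)" by blast
  qed
  moreover have "elts x \<subseteq> (\<Union>n. U n)" using UN_upper[of 0 UNIV U] by (simp add: U_def)
  ultimately show ?thesis using tc_least small_UN_nat[of U] U small_subset by metis
qed

text \<open>The foundation axiom speaks of sets only; a nonempty class is first cut down to a set by
  the transitive closure of one of its members.\<close>

lemma wf_mem: "wf {(x, y). x \<in> elts (y::'v::zfc_universe)}"
proof (rule wfI_min)
  fix x :: 'v and Q assume "x \<in> Q"
  define z where "z = vset (tc x \<inter> Q)"
  have z: "elts z = tc x \<inter> Q"
    unfolding z_def by (rule elts_vset) (rule small_subset[OF small_tc], auto)
  show "\<exists>z\<in>Q. \<forall>y. (y, z) \<in> {(x, y). x \<in> elts y} \<longrightarrow> y \<notin> Q"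
  proof (cases "tc x \<inter> Q = {}")
    case True
    then show ?thesis using \<open>x \<in> Q\<close> elts_subset_tc by fastforce
  next
    case False
    then obtain y where y: "y \<in> elts z" "elts y \<inter> elts z = {}" using foundation[of z] z by auto
    then have "elts y \<subseteq> tc x" using transitive_class_tc z by (auto simp: transitive_class_def)
    then show ?thesis using y z by (intro bexI[of _ y]) auto
  qed
qed

lemma mem_induct [case_names step]:
  assumes "\<And>x. (\<And>y. y \<in> elts x \<Longrightarrow> P y) \<Longrightarrow> P x"
  shows "P (x::'v::zfc_universe)"
  using wf_induct_rule[OF wf_mem, of P x] assms by auto

text \<open>The Mostowski collapse of the structure given by membership on \<open>X\<close>. It is total, so that its
  value at a member of \<open>X\<close> is computed from those members only that lie in \<open>X\<close>.\<close>

function collapse :: "'v::zfc_universe set \<Rightarrow> 'v \<Rightarrow> 'v" where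
  "collapse X x = vset (collapse X ` (elts x \<inter> X))"
  by auto
termination
  by (relation "inv_image {(x, y). x \<in> elts y} snd") (auto simp: wf_mem)

declare collapse.simps [simp del]

lemma elts_collapse: "elts (collapse X x) = collapse X ` (elts x \<inter> X)"
proof -
  have "small (elts x \<inter> X)" by (rule small_subset[OF small_elts]) auto
  then show ?thesis by (subst collapse.simps) simp
qed

lemma collapse_ident:
  assumes "elts x \<subseteq> X" "\<And>y. y \<in> elts x \<Longrightarrow> collapse X y = y"
  shows "collapse X x = x"
proof -
  have "elts (collapse X x) = collapse X ` elts x"
    using assms(1) by (simp add: elts_collapse Int_absorb2)
  also have "\<dots> = elts x" using assms(2) by simp
  finally show ?thesis by (rule extensionality)
qed

text \<open>The collapse moves nothing on a transitive part of \<open>X\<close>. This is what puts the critical point of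
  the inverse collapse at the first ordinal missing from \<open>X\<close>.\<close>

lemma collapse_ident_transitive:
  assumes "transitive_class A" "A \<subseteq> X" "x \<in> A"
  shows "collapse X x = x"
  using assms(3)
proof (induction x rule: mem_induct)
  case (step x)
  have sub: "elts x \<subseteq> A" using assms(1) step.prems unfolding transitive_class_def by blast
  show ?case
  proof (rule collapse_ident)
    show "elts x \<subseteq> X" using sub assms(2) by blast
    show "collapse X y = y" if "y \<in> elts x" for y using step.IH[OF that] that sub by blast
  qed
qed

text \<open>By membership induction on \<open>x\<close>: if \<open>x\<close> and \<open>y\<close> have the same collapse, then each member of
  \<open>x\<close> in \<open>X\<close> has the same collapse as a member of \<open>y\<close> in \<open>X\<close>, hence equals it, and vice versa.
  So \<open>x\<close> and \<open>y\<close> have the same members in \<open>X\<close>.\<close>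

lemma collapse_inj:
  assumes ext: "\<And>x y. x \<in> X \<Longrightarrow> y \<in> X \<Longrightarrow> elts x \<inter> X = elts y \<inter> X \<Longrightarrow> x = y"
  shows "inj_on (collapse X) X"
proof -
  have "\<forall>y\<in>X. collapse X x = collapse X y \<longrightarrow> x = y" if "x \<in> X" for x
    using that
  proof (induction x rule: mem_induct)
    case (step x)
    show ?case
    proof (intro ballI impI)
      fix y assume y: "y \<in> X" "collapse X x = collapse X y"
      then have im: "collapse X ` (elts x \<inter> X) = collapse X ` (elts y \<inter> X)"
        by (metis elts_collapse)
      have IH: "z = w" if "z \<in> elts x" "z \<in> X" "w \<in> X" "collapse X z = collapse X w" for z w
        using step.IH[of z] that by blast
      have "elts x \<inter> X \<subseteq> elts y"
      proof
        fix z assume z: "z \<in> elts x \<inter> X"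
        then obtain w where "w \<in> elts y \<inter> X" "collapse X z = collapse X w"
          using im by blast
        then show "z \<in> elts y" using IH[of z w] z by simp
      qed
      moreover have "elts y \<inter> X \<subseteq> elts x"
      proof
        fix w assume w: "w \<in> elts y \<inter> X"
        then obtain z where "z \<in> elts x \<inter> X" "collapse X z = collapse X w"
          using im by (metis (no_types, lifting) imageE imageI)
        then show "w \<in> elts x" using IH[of z w] w by auto
      qed
      ultimately have "elts x \<inter> X = elts y \<inter> X" by blast
      then show "x = y" using ext step y by blast
    qed
  qed
  then show ?thesis by (auto simp: inj_on_def)
qed

lemma collapse_mem_iff:
  assumes "inj_on (collapse X) X" "x \<in> X" "y \<in> X"
  shows "collapse X x \<in> elts (collapse X y) \<longleftrightarrow> x \<in> elts y"
  using assms by (auto simp: elts_collapse inj_on_def)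

lemma transitive_collapse: "transitive_class (collapse X ` X)"
  by (auto simp: transitive_class_def elts_collapse)


section \<open>Ordinals\<close>

lemma Ord_transitive: "Ord \<alpha> \<Longrightarrow> transitive_class (elts \<alpha>)"
  by (simp add: Ord_def)

lemma Ord_trans: "Ord \<alpha> \<Longrightarrow> \<beta> \<in> elts \<alpha> \<Longrightarrow> \<gamma> \<in> elts \<beta> \<Longrightarrow> \<gamma> \<in> elts \<alpha>"
  using Ord_transitive transitive_classD by blast

lemma Ord_subset: "Ord \<alpha> \<Longrightarrow> \<beta> \<in> elts \<alpha> \<Longrightarrow> elts \<beta> \<subseteq> elts \<alpha>"
  using Ord_trans by blast

lemma Ord_mem: "Ord \<alpha> \<Longrightarrow> \<beta> \<in> elts \<alpha> \<Longrightarrow> Ord \<beta>"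
  using Ord_trans[of \<alpha> \<beta>] unfolding Ord_def by blast

text \<open>Double membership induction: if two incomparable ordinals are chosen minimally, then all members
  of each are members of the other, and they coincide.\<close>

lemma Ord_linear: "Ord \<alpha> \<Longrightarrow> Ord \<beta> \<Longrightarrow> \<alpha> \<in> elts \<beta> \<or> \<alpha> = \<beta> \<or> \<beta> \<in> elts \<alpha>"
proof (induction \<alpha> arbitrary: \<beta> rule: mem_induct)
  case (step \<alpha>)
  note IH1 = step.IH and \<alpha> = step.prems(1)
  show ?case using step.prems(2)
  proof (induction \<beta> rule: mem_induct)
    case (step \<beta>)
    show ?case
    proof (rule ccontr)
      assume neg: "\<not> ?case"
      have "elts \<alpha> \<subseteq> elts \<beta>"
        using IH1[OF _ Ord_mem[OF \<alpha>] step.prems] neg Ord_trans[OF \<alpha>] by blast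
      moreover have "elts \<beta> \<subseteq> elts \<alpha>"
        using step.IH[OF _ Ord_mem[OF step.prems]] neg Ord_trans[OF step.prems] by blast
      ultimately show False using neg extensionality by blast
    qed
  qed
qed

lemma Ord_not_mem_iff: "Ord \<alpha> \<Longrightarrow> Ord \<beta> \<Longrightarrow> \<beta> \<notin> elts \<alpha> \<longleftrightarrow> elts \<alpha> \<subseteq> elts \<beta>"
  using Ord_linear Ord_subset mem_not_refl by blast

lemma Ord_vset:
  assumes "small A" "transitive_class A" "\<And>x. x \<in> A \<Longrightarrow> Ord x"
  shows "Ord (vset A)"
  using assms by (simp add: Ord_def)

definition ord_succ :: "'v::zfc_universe \<Rightarrow> 'v" where
  "ord_succ \<alpha> = vset (insert \<alpha> (elts \<alpha>))"

lemma elts_ord_succ [simp]: "elts (ord_succ \<alpha>) = insert \<alpha> (elts \<alpha>)"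
  by (simp add: ord_succ_def)

lemma Ord_ord_succ: "Ord \<alpha> \<Longrightarrow> Ord (ord_succ \<alpha>)"
  by (auto simp: Ord_def transitive_class_def)

lemma mem_minimal:
  fixes \<alpha> :: "'v::zfc_universe"
  assumes "P \<alpha>"
  obtains \<beta> where "P \<beta>" "\<And>\<gamma>. \<gamma> \<in> elts \<beta> \<Longrightarrow> \<not> P \<gamma>"
  using wfE_min[OF wf_mem, of \<alpha> "Collect P"] assms by auto

lemma Ord_least:
  assumes "Ord \<alpha>" "P \<alpha>"
  obtains \<beta> where "Ord \<beta>" "P \<beta>" "\<And>\<gamma>. Ord \<gamma> \<Longrightarrow> P \<gamma> \<Longrightarrow> elts \<beta> \<subseteq> elts \<gamma>"
proof -
  obtain \<beta> where "Ord \<beta> \<and> P \<beta>" "\<And>\<gamma>. \<gamma> \<in> elts \<beta> \<Longrightarrow> \<not> (Ord \<gamma> \<and> P \<gamma>)"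
    using mem_minimal[of "\<lambda>\<alpha>. Ord \<alpha> \<and> P \<alpha>" \<alpha>] assms by auto
  then show thesis using that Ord_not_mem_iff by blast
qed


section \<open>Cardinals\<close>

text \<open>A well-order of \<open>A\<close> is collapsed onto an ordinal by sending each element to the set of
  the values at its predecessors.\<close>

lemma small_eqpoll_Ord:
  fixes A :: "'v::zfc_universe set"
  assumes "small A"
  obtains \<alpha> :: 'v where "Ord \<alpha>" "elts \<alpha> \<approx> A"
proof -
  obtain r where r: "well_order_on A r" using well_order_on by blast
  define R where "R = r - Id"
  have wf: "wf R" using r by (simp add: R_def well_order_on_def)
  have RA: "(b, a) \<in> R \<Longrightarrow> b \<in> A \<and> a \<in> A" for a b
    using r by (auto simp: R_def well_order_on_def linear_order_on_def partial_order_on_def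
        preorder_on_def refl_on_def)
  have tr: "(c, b) \<in> R \<Longrightarrow> (b, a) \<in> R \<Longrightarrow> (c, a) \<in> R" for a b c
    using trans_diff_Id[of r] r unfolding R_def well_order_on_def linear_order_on_def
      partial_order_on_def preorder_on_def by (meson transD)
  have tot: "a \<in> A \<Longrightarrow> b \<in> A \<Longrightarrow> a \<noteq> b \<Longrightarrow> (a, b) \<in> R \<or> (b, a) \<in> R" for a b
    using r by (auto simp: R_def well_order_on_def linear_order_on_def total_on_def)
  define g :: "'v \<Rightarrow> 'v" where "g = wfrec R (\<lambda>g a. vset (g ` {b. (b, a) \<in> R}))"
  have g_eq: "g a = vset (g ` {b. (b, a) \<in> R})" for a
  proof -
    have "g a = vset (cut g R a ` {b. (b, a) \<in> R})"
      unfolding g_def by (subst wfrec[OF wf]) simp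
    also have "cut g R a ` {b. (b, a) \<in> R} = g ` {b. (b, a) \<in> R}"
      by (rule image_cong) (auto simp: cut_apply)
    finally show ?thesis .
  qed
  have "{b. (b, a) \<in> R} \<subseteq> A" for a using RA by blast
  then have "small {b. (b, a) \<in> R}" for a by (rule small_subset[OF assms])
  then have g: "elts (g a) = g ` {b. (b, a) \<in> R}" for a
    by (subst g_eq) (intro elts_vset small_image)
  have ord: "Ord (g a)" for a
    using wf
  proof (induction a rule: wf_induct_rule)
    case (less a)
    have "transitive_class (elts (g a))"
      using tr by (auto simp: transitive_class_def g)
    then show ?case using less by (auto simp: Ord_def g)
  qed
  have "Ord (vset (g ` A))"
    using assms ord RA by (intro Ord_vset) (auto simp: transitive_class_def g)
  moreover have "inj_on g A"
  proof (rule inj_onI, rule ccontr)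
    fix a b assume "a \<in> A" "b \<in> A" "g a = g b" "a \<noteq> b"
    then have "g a \<in> elts (g b) \<or> g b \<in> elts (g a)" using tot[of a b] unfolding g by blast
    then show False using \<open>g a = g b\<close> by simp
  qed
  then have "elts (vset (g ` A)) \<approx> A"
    using assms by (simp add: inj_on_image_eqpoll_self)
  ultimately show thesis by (rule that)
qed

text \<open>The least ordinal in bijection with \<open>A\<close>.\<close>

lemma small_eqpoll_Card:
  fixes A :: "'v::zfc_universe set"
  assumes "small A"
  obtains \<nu> :: 'v where "Card \<nu>" "elts \<nu> \<approx> A"
proof -
  obtain \<alpha> :: 'v where "Ord \<alpha>" "elts \<alpha> \<approx> A" using small_eqpoll_Ord[OF assms] .
  then obtain \<nu> :: 'v where \<nu>: "Ord \<nu>" "elts \<nu> \<approx> A" "\<And>\<gamma>. Ord \<gamma> \<Longrightarrow> elts \<gamma> \<approx> A \<Longrightarrow> elts \<nu> \<subseteq> elts \<gamma>"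
    using Ord_least[of \<alpha> "\<lambda>\<alpha>. elts \<alpha> \<approx> A"] by blast
  have "\<not> elts \<beta> \<approx> elts \<nu>" if "\<beta> \<in> elts \<nu>" for \<beta>
    using \<nu>(3)[of \<beta>] Ord_mem[OF \<nu>(1) that] \<nu>(2) that eqpoll_trans mem_not_refl by blast
  then have "Card \<nu>" using \<nu>(1) by (simp add: Card_def)
  then show thesis using \<nu>(2) that by blast
qed

lemma Card_Ord: "Card \<kappa> \<Longrightarrow> Ord \<kappa>"
  by (simp add: Card_def)

lemma Card_lesspoll: "Card \<kappa> \<Longrightarrow> \<beta> \<in> elts \<kappa> \<Longrightarrow> elts \<beta> \<prec> elts \<kappa>"
  unfolding lesspoll_def by (simp add: Card_def Ord_subset subset_imp_lepoll)

lemma Ord_lesspoll_mem: "Ord \<alpha> \<Longrightarrow> Ord \<beta> \<Longrightarrow> elts \<alpha> \<prec> elts \<beta> \<Longrightarrow> \<alpha> \<in> elts \<beta>"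
  by (metis Ord_not_mem_iff lesspoll_not_refl lesspoll_trans2 subset_imp_lepoll)

text \<open>Sizes below \<open>\<kappa>\<close> are measured by elements of \<open>\<kappa>\<close>. The set \<open>A\<close> may have any type, because
  an injection moves it into \<open>\<kappa>\<close>.\<close>

lemma lesspoll_eqpoll_Card:
  fixes \<kappa> :: "'v::zfc_universe"
  assumes "A \<prec> elts \<kappa>" "Ord \<kappa>"
  obtains \<nu> where "\<nu> \<in> elts \<kappa>" "Card \<nu>" "elts \<nu> \<approx> A"
proof -
  obtain f where f: "inj_on f A" "f ` A \<subseteq> elts \<kappa>"
    using lesspoll_imp_lepoll[OF assms(1)] by (auto simp: lepoll_def)
  have "small (f ` A)" using small_subset[OF small_elts f(2)] .
  then obtain \<nu> :: 'v where \<nu>: "Card \<nu>" "elts \<nu> \<approx> f ` A" by (rule small_eqpoll_Card)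
  have "elts \<nu> \<approx> A" using \<nu>(2) f(1) eqpoll_trans inj_on_image_eqpoll_self by blast
  moreover have "\<nu> \<in> elts \<kappa>"
    using Ord_lesspoll_mem[OF Card_Ord[OF \<nu>(1)] assms(2)] calculation assms(1)
      eq_lesspoll_trans by blast
  ultimately show thesis using that \<nu> by blast
qed

text \<open>Cantor's theorem, applied to the power set.\<close>

lemma larger_Card:
  fixes A :: "'v::zfc_universe set"
  assumes "small A"
  obtains \<theta> :: 'v where "Card \<theta>" "A \<prec> elts \<theta>"
proof -
  have "inj_on elts (elts (powset (vset A)))" by (auto simp: inj_on_def)
  moreover have "elts ` elts (powset (vset A)) = Pow A"
  proof
    show "Pow A \<subseteq> elts ` elts (powset (vset A))"
    proof
      fix B assume "B \<in> Pow A"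
      then have "small B" using assms small_subset by blast
      then show "B \<in> elts ` elts (powset (vset A))" using \<open>B \<in> Pow A\<close> assms
        by (intro image_eqI[of _ _ "vset B"]) auto
    qed
  qed (use assms in auto)
  ultimately have "elts (powset (vset A)) \<approx> Pow A"
    by (metis eqpoll_sym inj_on_image_eqpoll_self)
  moreover obtain \<theta> :: 'v where "Card \<theta>" "elts \<theta> \<approx> elts (powset (vset A))"
    using small_eqpoll_Card[OF small_elts] .
  ultimately show thesis
    using that lesspoll_Pow_self lesspoll_eq_trans eqpoll_trans eqpoll_sym by metis
qed

text \<open>Otherwise \<open>\<kappa>\<close> would be the successor of \<open>\<alpha>\<close>, and adding one point to an infinite set does
  not change its cardinality.\<close>

lemma Card_infinite_limit:
  assumes "Card \<kappa>" "infinite (elts \<kappa>)" "\<alpha> \<in> elts \<kappa>"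
  shows "ord_succ \<alpha> \<in> elts \<kappa>"
proof (rule ccontr)
  have ord: "Ord \<kappa>" "Ord \<alpha>" using assms Card_Ord Ord_mem by blast+
  assume "ord_succ \<alpha> \<notin> elts \<kappa>"
  then have sub: "elts \<kappa> \<subseteq> insert \<alpha> (elts \<alpha>)"
    using Ord_not_mem_iff[OF ord(1) Ord_ord_succ[OF ord(2)]] by simp
  then have "infinite (elts \<alpha>)" using assms(2) finite_subset by blast
  then have "elts \<kappa> \<lesssim> elts \<alpha>"
    using lepoll_trans[OF subset_imp_lepoll[OF sub] infinite_insert_lepoll] by blast
  then show False using lesspoll_trans1[OF _ Card_lesspoll[OF assms(1,3)]] by blast
qed

text \<open>Both factors embed into one \<open>\<mu> < \<kappa>\<close>, and the square of an infinite set has the size of the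
  set.\<close>

lemma lesspoll_Times:
  assumes "Card \<kappa>" "infinite (elts \<kappa>)" "A \<prec> elts \<kappa>" "B \<prec> elts \<kappa>"
  shows "A \<times> B \<prec> elts \<kappa>"
proof -
  obtain \<alpha> where \<alpha>: "\<alpha> \<in> elts \<kappa>" "Card \<alpha>" "elts \<alpha> \<approx> A"
    using lesspoll_eqpoll_Card[OF assms(3) Card_Ord[OF assms(1)]] .
  obtain \<beta> where \<beta>: "\<beta> \<in> elts \<kappa>" "Card \<beta>" "elts \<beta> \<approx> B"
    using lesspoll_eqpoll_Card[OF assms(4) Card_Ord[OF assms(1)]] .
  obtain \<mu> where \<mu>: "\<mu> \<in> elts \<kappa>" "elts \<alpha> \<subseteq> elts \<mu>" "elts \<beta> \<subseteq> elts \<mu>"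
    using \<alpha> \<beta> Ord_linear[of \<alpha> \<beta>] Card_Ord Ord_subset by blast
  have "A \<lesssim> elts \<mu>" "B \<lesssim> elts \<mu>"
    using \<alpha>(3) \<beta>(3) \<mu> eqpoll_sym lepoll_trans1 subset_imp_lepoll by metis+
  then have AB: "A \<times> B \<lesssim> elts \<mu> \<times> elts \<mu>" by (rule times_lepoll_mono)
  show ?thesis
  proof (cases "finite (elts \<mu>)")
    case True
    then show ?thesis using AB assms(2)
      by (meson finite_SigmaI finite_lesspoll_infinite lesspoll_trans1)
  next
    case False
    then have "elts \<mu> \<times> elts \<mu> \<approx> elts \<mu>"
      by (simp add: card_of_Times_same_infinite eqpoll_iff_card_of_ordIso)
    then show ?thesis
      using AB Card_lesspoll[OF assms(1) \<mu>(1)] eq_lesspoll_trans lesspoll_trans1 by blast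
  qed
qed

text \<open>The definition of regularity bounds subsets of \<open>\<kappa>\<close>. Applied to the set of the cardinalities of
  the \<open>B i\<close> it gives one \<open>\<beta> < \<kappa>\<close> onto which all of them map, so the union is an image of
  \<open>I \<times> \<beta>\<close>.\<close>

lemma regular_UN:
  assumes reg: "regular_cardinal \<kappa>" and I: "I \<prec> elts \<kappa>"
    and B: "\<And>i. i \<in> I \<Longrightarrow> B i \<prec> elts \<kappa>"
  shows "(\<Union>i\<in>I. B i) \<prec> elts \<kappa>"
proof -
  have \<kappa>: "Card \<kappa>" "infinite (elts \<kappa>)" using reg by (auto simp: regular_cardinal_def)
  have "\<exists>\<nu>. \<nu> \<in> elts \<kappa> \<and> elts \<nu> \<approx> B i" if "i \<in> I" for i
    using lesspoll_eqpoll_Card[OF B[OF that] Card_Ord[OF \<kappa>(1)]] by metis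
  then obtain \<nu> where \<nu>: "\<And>i. i \<in> I \<Longrightarrow> \<nu> i \<in> elts \<kappa> \<and> elts (\<nu> i) \<approx> B i" by metis
  have "\<nu> ` I \<prec> elts \<kappa>" using I image_lepoll lesspoll_trans1 by blast
  then obtain \<beta> where \<beta>: "\<beta> \<in> elts \<kappa>" "\<nu> ` I \<subseteq> elts \<beta>"
    using reg \<nu> unfolding regular_cardinal_def by (metis (no_types, lifting) image_subsetI)
  have "\<exists>g. B i \<subseteq> g ` elts \<beta>" if "i \<in> I" for i
  proof -
    have "elts (\<nu> i) \<subseteq> elts \<beta>"
      using Ord_subset[OF Ord_mem[OF Card_Ord[OF \<kappa>(1)] \<beta>(1)]] \<beta>(2) that by blast
    then have "B i \<lesssim> elts \<beta>"
      using \<nu>[OF that] by (meson eqpoll_sym lepoll_trans1 subset_imp_lepoll)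
    then show ?thesis by (simp add: lepoll_iff)
  qed
  then obtain g where g: "\<And>i. i \<in> I \<Longrightarrow> B i \<subseteq> g i ` elts \<beta>" by metis
  have "(\<Union>i\<in>I. B i) \<subseteq> (\<lambda>(i, \<xi>). g i \<xi>) ` (I \<times> elts \<beta>)" using g by force
  then have "(\<Union>i\<in>I. B i) \<lesssim> I \<times> elts \<beta>" by (rule subset_image_lepoll)
  also have "\<dots> \<prec> elts \<kappa>"
    by (rule lesspoll_Times[OF \<kappa> I Card_lesspoll[OF \<kappa>(1) \<beta>(1)]])
  finally show ?thesis .
qed

lemma countable_lesspoll_uncountable:
  assumes "countable A" "uncountable B" shows "A \<prec> B"
proof -
  have "A \<lesssim> (UNIV::nat set)" using assms(1) by (auto simp: countable_def lepoll_def)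
  also have "(UNIV::nat set) \<lesssim> B"
    using infinite_le_lepoll[of B] uncountable_infinite[OF assms(2)] by simp
  finally have "A \<lesssim> B" .
  moreover have "\<not> A \<approx> B"
    using assms countable_eqpoll[OF assms(1), of B] eqpoll_sym[of A B] by blast
  ultimately show ?thesis by (simp add: lesspoll_def)
qed

lemma regular_UN_nat:
  assumes "regular_cardinal \<kappa>" "uncountable (elts \<kappa>)" "\<And>n::nat. B n \<prec> elts \<kappa>"
  shows "(\<Union>n. B n) \<prec> elts \<kappa>"
  using assms countable_lesspoll_uncountable[of "UNIV::nat set"] by (intro regular_UN) auto

lemma regular_Un:
  assumes "regular_cardinal \<kappa>" "A \<prec> elts \<kappa>" "B \<prec> elts \<kappa>"
  shows "A \<union> B \<prec> elts \<kappa>"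
proof -
  have "(\<Union>i\<in>{True, False}. if i then A else B) \<prec> elts \<kappa>"
    using assms by (intro regular_UN)
      (auto simp: regular_cardinal_def finite_lesspoll_infinite)
  then show ?thesis by (simp add: Un_commute)
qed

text \<open>A countable union over the length; the sets of lists of fixed length are handled as iterated
  products. Uncountability of \<open>\<kappa>\<close> enters here.\<close>

lemma regular_lists:
  assumes reg: "regular_cardinal \<kappa>" "uncountable (elts \<kappa>)" and A: "A \<prec> elts \<kappa>"
  shows "lists A \<prec> elts \<kappa>"
proof -
  have \<kappa>: "Card \<kappa>" "infinite (elts \<kappa>)" using reg by (auto simp: regular_cardinal_def)
  have "{xs \<in> lists A. length xs = n} \<prec> elts \<kappa>" for n
  proof (induction n)
    case 0
    have "{xs \<in> lists A. length xs = 0} = {[]}" by auto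
    then show ?case using \<kappa> by (simp add: finite_lesspoll_infinite)
  next
    case (Suc n)
    have "{xs \<in> lists A. length xs = Suc n}
        \<subseteq> (\<lambda>(x, xs). x # xs) ` (A \<times> {xs \<in> lists A. length xs = n})"
    proof
      fix ys assume "ys \<in> {xs \<in> lists A. length xs = Suc n}"
      then show "ys \<in> (\<lambda>(x, xs). x # xs) ` (A \<times> {xs \<in> lists A. length xs = n})"
        by (cases ys) auto
    qed
    then have "{xs \<in> lists A. length xs = Suc n} \<lesssim> A \<times> {xs \<in> lists A. length xs = n}"
      by (rule subset_image_lepoll)
    also have "\<dots> \<prec> elts \<kappa>" by (rule lesspoll_Times[OF \<kappa> A Suc])
    finally show ?case .
  qed
  then have "(\<Union>n. {xs \<in> lists A. length xs = n}) \<prec> elts \<kappa>"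
    by (rule regular_UN_nat[OF reg])
  moreover have "(\<Union>n. {xs \<in> lists A. length xs = n}) = lists A" by auto
  ultimately show ?thesis by simp
qed


section \<open>Sets of small transitive closure\<close>

lemma tc_subset_in_H: "x \<in> H \<theta> \<Longrightarrow> tc y \<subseteq> tc x \<Longrightarrow> y \<in> H \<theta>"
  unfolding H_def mem_Collect_eq by (rule lesspoll_trans1[OF subset_imp_lepoll])

lemma transitive_class_H: "transitive_class (H \<theta>)"
  unfolding transitive_class_def using tc_subset_in_H tc_mem by blast

lemma H_subset_closed: "x \<in> H \<theta> \<Longrightarrow> elts y \<subseteq> elts x \<Longrightarrow> y \<in> H \<theta>"
  using tc_subset_in_H tc_mono by blast

text \<open>The way in which sets are recognised as members of \<open>H \<theta>\<close>: one transitive set of size below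
  \<open>\<theta>\<close> has all its subsets in \<open>H \<theta>\<close>.\<close>

lemma subset_transitive_in_H:
  "transitive_class T \<Longrightarrow> T \<prec> elts \<theta> \<Longrightarrow> elts y \<subseteq> T \<Longrightarrow> y \<in> H \<theta>"
  unfolding H_def mem_Collect_eq
  by (rule lesspoll_trans1[OF subset_imp_lepoll[OF tc_least]])


section \<open>Relativized notions and their formulas\<close>

definition fAll :: "nat \<Rightarrow> fm \<Rightarrow> fm" where "fAll n p = Neg (Ex n (Neg p))"
definition fImp :: "fm \<Rightarrow> fm \<Rightarrow> fm" where "fImp p q = Neg (Conj p (Neg q))"
definition fOr :: "fm \<Rightarrow> fm \<Rightarrow> fm" where "fOr p q = Neg (Conj (Neg p) (Neg q))"
definition fIff :: "fm \<Rightarrow> fm \<Rightarrow> fm" where "fIff p q = Conj (fImp p q) (fImp q p)"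

lemma sat_connectives [simp]:
  "sat A (fAll n p) s \<longleftrightarrow> (\<forall>x\<in>A. sat A p (s(n := x)))"
  "sat A (fImp p q) s \<longleftrightarrow> (sat A p s \<longrightarrow> sat A q s)"
  "sat A (fOr p q) s \<longleftrightarrow> sat A p s \<or> sat A q s"
  "sat A (fIff p q) s \<longleftrightarrow> (sat A p s \<longleftrightarrow> sat A q s)"
  by (auto simp: fAll_def fImp_def fOr_def fIff_def)

text \<open>The predicates \<open>rel_...\<close> are set-theoretic notions with all quantifiers restricted to a class
  \<open>A\<close>. Each is defined by a formula, so that elementary embeddings transfer it, and on transitive
  classes the basic ones agree with the notions that they relativize.\<close>

definition rel_Ord :: "'v::zfc_universe set \<Rightarrow> 'v \<Rightarrow> bool" where
  "rel_Ord A x \<longleftrightarrow>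
     (\<forall>y\<in>A. y \<in> elts x \<longrightarrow> (\<forall>z\<in>A. z \<in> elts y \<longrightarrow>
        z \<in> elts x \<and> (\<forall>w\<in>A. w \<in> elts z \<longrightarrow> w \<in> elts y)))"

definition rel_sub :: "'v::zfc_universe set \<Rightarrow> 'v \<Rightarrow> 'v \<Rightarrow> bool" where
  "rel_sub A x y \<longleftrightarrow> (\<forall>z\<in>A. z \<in> elts x \<longrightarrow> z \<in> elts y)"

definition rel_succ :: "'v::zfc_universe set \<Rightarrow> 'v \<Rightarrow> 'v \<Rightarrow> bool" where
  "rel_succ A x y \<longleftrightarrow> (\<forall>z\<in>A. z \<in> elts y \<longleftrightarrow> z \<in> elts x \<or> z = x)"

definition rel_opair :: "'v::zfc_universe set \<Rightarrow> 'v \<Rightarrow> 'v \<Rightarrow> 'v \<Rightarrow> bool" where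
  "rel_opair A p a b \<longleftrightarrow> (\<exists>u\<in>A. \<exists>v\<in>A. (\<forall>w\<in>A. w \<in> elts u \<longleftrightarrow> w = a) \<and>
     (\<forall>w\<in>A. w \<in> elts v \<longleftrightarrow> w = a \<or> w = b) \<and> (\<forall>w\<in>A. w \<in> elts p \<longleftrightarrow> w = u \<or> w = v))"

definition rel_app :: "'v::zfc_universe set \<Rightarrow> 'v \<Rightarrow> 'v \<Rightarrow> 'v \<Rightarrow> bool" where
  "rel_app A f a b \<longleftrightarrow> (\<exists>p\<in>A. p \<in> elts f \<and> rel_opair A p a b)"

text \<open>Here \<open>f\<close> is read as a set of ordered pairs: it is single-valued and maps a subset of \<open>\<gamma>\<close> onto a
  superset of \<open>c\<close>.\<close>

definition rel_enum :: "'v::zfc_universe set \<Rightarrow> 'v \<Rightarrow> 'v \<Rightarrow> 'v \<Rightarrow> bool" where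
  "rel_enum A c \<gamma> f \<longleftrightarrow>
     (\<forall>z\<in>A. z \<in> elts c \<longrightarrow> (\<exists>\<xi>\<in>A. \<xi> \<in> elts \<gamma> \<and> rel_app A f \<xi> z)) \<and>
     (\<forall>\<xi>\<in>A. \<forall>z\<in>A. \<forall>z'\<in>A. rel_app A f \<xi> z \<and> rel_app A f \<xi> z' \<longrightarrow> z = z')"

definition rel_lt_card :: "'v::zfc_universe set \<Rightarrow> 'v \<Rightarrow> 'v \<Rightarrow> bool" where
  "rel_lt_card A c \<kappa> \<longleftrightarrow> (\<exists>\<gamma>\<in>A. \<gamma> \<in> elts \<kappa> \<and> (\<exists>f\<in>A. rel_enum A c \<gamma> f))"

definition rel_directed :: "'v::zfc_universe set \<Rightarrow> 'v \<Rightarrow> bool" where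
  "rel_directed A B \<longleftrightarrow> (\<exists>x\<in>A. x \<in> elts B) \<and>
     (\<forall>x\<in>A. \<forall>y\<in>A. x \<in> elts B \<and> y \<in> elts B \<longrightarrow>
        (\<exists>z\<in>A. z \<in> elts B \<and> rel_sub A x z \<and> rel_sub A y z))"

text \<open>The set \<open>c\<close> shows that \<open>\<kappa>\<close> is singular: it has fewer than \<open>\<kappa>\<close> members and is not bounded in \<open>\<kappa>\<close>.\<close>

definition rel_singular :: "'v::zfc_universe set \<Rightarrow> 'v \<Rightarrow> 'v \<Rightarrow> bool" where
  "rel_singular A c \<kappa> \<longleftrightarrow> rel_sub A c \<kappa> \<and> rel_lt_card A c \<kappa> \<and>
     (\<forall>\<beta>\<in>A. \<beta> \<in> elts \<kappa> \<longrightarrow> (\<exists>z\<in>A. z \<in> elts c \<and> z \<notin> elts \<beta>))"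

text \<open>The property of a club \<open>C\<close> that is reflected. Here \<open>g\<close> is the graph of a list \<open>d\<close>. The family
  \<open>C\<close> is directed, covers \<open>lam\<close>, consists of subsets of \<open>lam\<close> of size less than \<open>\<kappa>\<close>, and no set \<open>b\<close>
  in the domain of \<open>d\<close> that is the union of a directed subfamily \<open>B\<close> of \<open>C\<close> satisfies \<open>d b = D \<inter> b\<close>.
  A club that avoids the set of all \<open>b\<close> with \<open>d b = D \<inter> b\<close> has this property, since clubs are closed
  under directed unions of size less than \<open>\<kappa>\<close>.
  The advantage over a direct description of clubs is that increasing sequences need not be mentioned.\<close>

definition rel_avoids ::
    "'v::zfc_universe set \<Rightarrow> 'v \<Rightarrow> 'v \<Rightarrow> 'v \<Rightarrow> 'v \<Rightarrow> 'v \<Rightarrow> bool" where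
  "rel_avoids A C \<kappa> lam D g \<longleftrightarrow> rel_directed A C \<and>
     (\<forall>x\<in>A. x \<in> elts lam \<longrightarrow> (\<exists>c\<in>A. c \<in> elts C \<and> x \<in> elts c)) \<and>
     (\<forall>c\<in>A. c \<in> elts C \<longrightarrow> rel_sub A c lam \<and> rel_lt_card A c \<kappa>) \<and>
     (\<forall>B\<in>A. \<forall>b\<in>A. \<forall>y\<in>A. rel_sub A B C \<and> rel_directed A B \<and>
        (\<forall>z\<in>A. z \<in> elts b \<longleftrightarrow> (\<exists>c\<in>A. c \<in> elts B \<and> z \<in> elts c)) \<and> rel_app A g b y \<longrightarrow>
        \<not> (\<forall>z\<in>A. z \<in> elts y \<longleftrightarrow> z \<in> elts b \<and> z \<in> elts D))"

text \<open>The numbers of bound variables are chosen apart to rule out capture: free variables are numbered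
  from 0, the main formulas bind 1 to 9, the auxiliary ones bind 8 to 12 (cardinality), 13
  (inclusion), 14 to 16 (directedness) and 20 to 23 (ordered pairs). This explains the bounds in the
  lemmas about satisfaction.\<close>

definition fOrd :: fm where
  "fOrd = fAll 1 (fImp (Mem 1 0) (fAll 2 (fImp (Mem 2 1)
     (Conj (Mem 2 0) (fAll 3 (fImp (Mem 3 2) (Mem 3 1)))))))"

definition fSub :: "nat \<Rightarrow> nat \<Rightarrow> fm" where
  "fSub x y = fAll 13 (fImp (Mem 13 x) (Mem 13 y))"

definition fSucc :: fm where
  "fSucc = fAll 2 (fIff (Mem 2 1) (fOr (Mem 2 0) (Eq 2 0)))"

definition fApp :: "nat \<Rightarrow> nat \<Rightarrow> nat \<Rightarrow> fm" where
  "fApp f a b = Ex 20 (Conj (Mem 20 f) (Ex 21 (Ex 22 (Conj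
     (fAll 23 (fIff (Mem 23 21) (Eq 23 a))) (Conj
     (fAll 23 (fIff (Mem 23 22) (fOr (Eq 23 a) (Eq 23 b))))
     (fAll 23 (fIff (Mem 23 20) (fOr (Eq 23 21) (Eq 23 22)))))))))"

definition fLtCard :: "nat \<Rightarrow> nat \<Rightarrow> fm" where
  "fLtCard c \<kappa> = Ex 8 (Conj (Mem 8 \<kappa>) (Ex 9 (Conj
     (fAll 10 (fImp (Mem 10 c) (Ex 11 (Conj (Mem 11 8) (fApp 9 11 10)))))
     (fAll 10 (fAll 11 (fAll 12 (fImp (Conj (fApp 9 10 11) (fApp 9 10 12)) (Eq 11 12))))))))"

definition fEnum :: fm where
  "fEnum = Conj
     (fAll 10 (fImp (Mem 10 0) (Ex 11 (Conj (Mem 11 1) (fApp 2 11 10)))))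
     (fAll 10 (fAll 11 (fAll 12 (fImp (Conj (fApp 2 10 11) (fApp 2 10 12)) (Eq 11 12)))))"

definition fDirected :: "nat \<Rightarrow> fm" where
  "fDirected B = Conj (Ex 14 (Mem 14 B)) (fAll 14 (fAll 15 (fImp (Conj (Mem 14 B) (Mem 15 B))
     (Ex 16 (Conj (Mem 16 B) (Conj (fSub 14 16) (fSub 15 16)))))))"

definition fSingular :: fm where
  "fSingular = Conj (fSub 0 1) (Conj (fLtCard 0 1)
     (fAll 2 (fImp (Mem 2 1) (Ex 3 (Conj (Mem 3 0) (Neg (Mem 3 2)))))))"

definition fAvoids :: fm where
  "fAvoids = Conj (fDirected 0) (Conj
     (fAll 5 (fImp (Mem 5 2) (Ex 6 (Conj (Mem 6 0) (Mem 5 6))))) (Conj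
     (fAll 5 (fImp (Mem 5 0) (Conj (fSub 5 2) (fLtCard 5 1))))
     (fAll 5 (fAll 6 (fAll 7 (fImp (Conj (fSub 5 0) (Conj (fDirected 5) (Conj
        (fAll 8 (fIff (Mem 8 6) (Ex 9 (Conj (Mem 9 5) (Mem 8 9))))) (fApp 4 6 7))))
        (Neg (fAll 8 (fIff (Mem 8 7) (Conj (Mem 8 6) (Mem 8 3)))))))))))"

lemma sat_fOrd: "sat A fOrd s \<longleftrightarrow> rel_Ord A (s 0)"
  by (simp add: fOrd_def rel_Ord_def)

lemma sat_fSub: "x < 13 \<or> 13 < x \<Longrightarrow> y < 13 \<or> 13 < y \<Longrightarrow> sat A (fSub x y) s \<longleftrightarrow> rel_sub A (s x) (s y)"
  by (auto simp: fSub_def rel_sub_def)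

lemma sat_fSucc: "sat A fSucc s \<longleftrightarrow> rel_succ A (s 0) (s 1)"
  by (simp add: fSucc_def rel_succ_def)

lemma sat_fApp:
  "f < 20 \<Longrightarrow> a < 20 \<Longrightarrow> b < 20 \<Longrightarrow> sat A (fApp f a b) s \<longleftrightarrow> rel_app A (s f) (s a) (s b)"
  by (simp add: fApp_def rel_app_def rel_opair_def)

lemma sat_fEnum: "sat A fEnum s \<longleftrightarrow> rel_enum A (s 0) (s 1) (s 2)"
  by (simp add: fEnum_def rel_enum_def sat_fApp)

lemma sat_fLtCard: "c < 8 \<Longrightarrow> \<kappa> < 8 \<Longrightarrow> sat A (fLtCard c \<kappa>) s \<longleftrightarrow> rel_lt_card A (s c) (s \<kappa>)"
  by (simp add: fLtCard_def rel_lt_card_def rel_enum_def sat_fApp)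

lemma sat_fDirected: "B < 13 \<Longrightarrow> sat A (fDirected B) s \<longleftrightarrow> rel_directed A (s B)"
  by (simp add: fDirected_def rel_directed_def sat_fSub)

lemma sat_fSingular: "sat A fSingular s \<longleftrightarrow> rel_singular A (s 0) (s 1)"
  by (simp add: fSingular_def rel_singular_def sat_fSub sat_fLtCard)

lemma sat_fAvoids: "sat A fAvoids s \<longleftrightarrow> rel_avoids A (s 0) (s 1) (s 2) (s 3) (s 4)"
  by (simp add: fAvoids_def rel_avoids_def sat_fSub sat_fDirected sat_fLtCard sat_fApp)


section \<open>Absoluteness\<close>

context
  fixes A :: "'v::zfc_universe set"
  assumes A: "transitive_class A"
begin

lemma mem_transitive: "y \<in> elts x \<Longrightarrow> x \<in> A \<Longrightarrow> y \<in> A"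
  using A by (auto simp: transitive_class_def)

lemma Ball_rel: "x \<in> A \<Longrightarrow> (\<forall>y\<in>A. y \<in> elts x \<longrightarrow> P y) \<longleftrightarrow> (\<forall>y\<in>elts x. P y)"
  using mem_transitive by blast

lemma rel_Ord_abs:
  assumes "x \<in> A"
  shows "rel_Ord A x \<longleftrightarrow> Ord x"
proof -
  have "rel_Ord A x \<longleftrightarrow> (\<forall>y\<in>elts x. \<forall>z\<in>elts y. z \<in> elts x \<and> (\<forall>w\<in>elts z. w \<in> elts y))"
    unfolding rel_Ord_def using assms by (simp add: Ball_rel mem_transitive cong: ball_cong)
  also have "\<dots> \<longleftrightarrow> Ord x"
    unfolding Ord_def transitive_class_def Ball_def subset_iff by blast
  finally show ?thesis .
qed

lemma rel_sub_abs: "x \<in> A \<Longrightarrow> rel_sub A x y \<longleftrightarrow> elts x \<subseteq> elts y"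
  unfolding rel_sub_def using mem_transitive by blast

lemma rel_succ_abs:
  "x \<in> A \<Longrightarrow> y \<in> A \<Longrightarrow> rel_succ A x y \<longleftrightarrow> elts y = insert x (elts x)"
  unfolding rel_succ_def using mem_transitive by blast

lemma rel_opair_abs:
  assumes "p \<in> A" "a \<in> A" "b \<in> A"
  shows "rel_opair A p a b \<longleftrightarrow> p = opair a b"
proof -
  have eq: "(\<forall>w\<in>A. w \<in> elts u \<longleftrightarrow> w = x \<or> w = y) \<longleftrightarrow> elts u = {x, y}"
    if "u \<in> A" "x \<in> A" "y \<in> A" for u x y
  proof -
    have "elts u \<subseteq> A" using mem_transitive that by blast
    then show ?thesis using that by auto
  qed
  have "(\<forall>w\<in>A. w \<in> elts u \<longleftrightarrow> w = a) \<longleftrightarrow> elts u = {a}" if "u \<in> A" for u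
    using eq[of u a a] that assms by simp
  then have "rel_opair A p a b \<longleftrightarrow>
      (\<exists>u\<in>A. \<exists>v\<in>A. elts u = {a} \<and> elts v = {a, b} \<and> elts p = {u, v})"
    unfolding rel_opair_def using eq assms by (auto intro!: bex_cong)
  also have "\<dots> \<longleftrightarrow> p = opair a b"
    unfolding opair_iff_elts using mem_transitive[OF _ assms(1)] by blast
  finally show ?thesis .
qed

lemma rel_app_abs:
  "f \<in> A \<Longrightarrow> a \<in> A \<Longrightarrow> b \<in> A \<Longrightarrow> rel_app A f a b \<longleftrightarrow> opair a b \<in> elts f"
  unfolding rel_app_def using rel_opair_abs mem_transitive by blast

lemma rel_directed_abs:
  assumes "B \<in> A"
  shows "rel_directed A B \<longleftrightarrow> elts B \<noteq> {} \<and>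
     (\<forall>x\<in>elts B. \<forall>y\<in>elts B. \<exists>z\<in>elts B. elts x \<subseteq> elts z \<and> elts y \<subseteq> elts z)"
proof -
  have B: "x \<in> A" if "x \<in> elts B" for x using mem_transitive that assms by blast
  have "rel_directed A B \<longleftrightarrow> (\<exists>x. x \<in> elts B) \<and> (\<forall>x\<in>elts B. \<forall>y\<in>elts B.
      \<exists>z\<in>elts B. rel_sub A x z \<and> rel_sub A y z)"
    unfolding rel_directed_def using B by blast
  also have "\<dots> \<longleftrightarrow> elts B \<noteq> {} \<and> (\<forall>x\<in>elts B. \<forall>y\<in>elts B.
      \<exists>z\<in>elts B. elts x \<subseteq> elts z \<and> elts y \<subseteq> elts z)"
    using B by (simp add: rel_sub_abs ex_in_conv)
  finally show ?thesis .
qed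

end


section \<open>Elementary embeddings of transitive classes\<close>

locale elementary =
  fixes M N :: "'v::zfc_universe set" and j :: "'v \<Rightarrow> 'v"
  assumes trans_M: "transitive_class M" and trans_N: "transitive_class N"
    and elem: "elementary_embedding M N j"
begin

lemma j_in: "x \<in> M \<Longrightarrow> j x \<in> N"
  using elem by (auto simp: elementary_embedding_def)

lemma M_mem: "y \<in> elts x \<Longrightarrow> x \<in> M \<Longrightarrow> y \<in> M"
  using trans_M transitive_classD by blast

lemma elem_sat: "range s \<subseteq> M \<Longrightarrow> sat M \<phi> s \<longleftrightarrow> sat N \<phi> (j \<circ> s)"
  using elem by (simp add: elementary_embedding_def)

text \<open>Assignments from lists of parameters. Beyond the list the value is the first parameter, so that
  the range stays inside \<open>M\<close>.\<close>

definition env :: "'v list \<Rightarrow> nat \<Rightarrow> 'v" where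
  "env xs i = (if i < length xs then xs ! i else hd xs)"

lemma elem_env: "set xs \<subseteq> M \<Longrightarrow> xs \<noteq> [] \<Longrightarrow> sat M \<phi> (env xs) \<longleftrightarrow> sat N \<phi> (j \<circ> env xs)"
  by (rule elem_sat) (auto simp: env_def)

lemma j_mem: "x \<in> M \<Longrightarrow> y \<in> M \<Longrightarrow> j x \<in> elts (j y) \<longleftrightarrow> x \<in> elts y"
  using elem_env[of "[x, y]" "Mem 0 1"] by (simp add: env_def)

lemma j_eq: "x \<in> M \<Longrightarrow> y \<in> M \<Longrightarrow> j x = j y \<longleftrightarrow> x = y"
  using elem_env[of "[x, y]" "Eq 0 1"] by (simp add: env_def)

lemma j_Ord: "x \<in> M \<Longrightarrow> Ord (j x) \<longleftrightarrow> Ord x"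
  using elem_env[of "[x]" fOrd] rel_Ord_abs trans_M trans_N j_in
  by (auto simp: env_def sat_fOrd)

lemma j_subset: "x \<in> M \<Longrightarrow> y \<in> M \<Longrightarrow> elts (j x) \<subseteq> elts (j y) \<longleftrightarrow> elts x \<subseteq> elts y"
  using elem_env[of "[x, y]" "fSub 0 1"] rel_sub_abs trans_M trans_N j_in
  by (auto simp: env_def sat_fSub)

lemma j_succ:
  "x \<in> M \<Longrightarrow> y \<in> M \<Longrightarrow> elts (j y) = insert (j x) (elts (j x)) \<longleftrightarrow> elts y = insert x (elts x)"
  using elem_env[of "[x, y]" fSucc] rel_succ_abs trans_M trans_N j_in
  by (auto simp: env_def sat_fSucc)

lemma j_empty: "x \<in> M \<Longrightarrow> elts x = {} \<Longrightarrow> elts (j x) = {}"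
  using elem_env[of "[x]" "fAll 1 (Neg (Mem 1 0))"] transitive_classD[OF trans_N j_in]
  by (auto simp: env_def)

lemma j_rel_app: "f \<in> M \<Longrightarrow> a \<in> M \<Longrightarrow> b \<in> M \<Longrightarrow> rel_app M f a b \<longleftrightarrow> rel_app N (j f) (j a) (j b)"
  using elem_env[of "[f, a, b]" "fApp 0 1 2"] by (simp add: env_def sat_fApp)

lemma j_rel_enum:
  "c \<in> M \<Longrightarrow> \<gamma> \<in> M \<Longrightarrow> f \<in> M \<Longrightarrow> rel_enum M c \<gamma> f \<longleftrightarrow> rel_enum N (j c) (j \<gamma>) (j f)"
  using elem_env[of "[c, \<gamma>, f]" fEnum] by (simp add: env_def sat_fEnum)

text \<open>If \<open>j f\<close> relates \<open>j a\<close> to some member of \<open>j c\<close>, then \<open>f\<close> relates \<open>a\<close> to some member of \<open>c\<close>.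
  The two lemmas after this one reflect an existential statement in the same way, and then carry the
  witness back to \<open>N\<close>.\<close>

lemma reflect_app:
  assumes "{c, f, a} \<subseteq> M" "z \<in> N" "z \<in> elts (j c)" "rel_app N (j f) (j a) z"
  obtains z' where "z' \<in> M" "z' \<in> elts c" "rel_app M f a z'"
proof -
  have "sat N (Ex 3 (Conj (Mem 3 0) (fApp 1 2 3))) (j \<circ> env [c, f, a])"
    using assms by (auto simp: env_def sat_fApp)
  then have "sat M (Ex 3 (Conj (Mem 3 0) (fApp 1 2 3))) (env [c, f, a])"
    using elem_env[of "[c, f, a]" "Ex 3 (Conj (Mem 3 0) (fApp 1 2 3))"] assms by simp
  then show thesis using that by (auto simp: env_def sat_fApp)
qed

lemma reflect_singular:
  assumes "c \<in> N" "rel_singular N c (j \<kappa>)" "\<kappa> \<in> M"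
  obtains c' where "c' \<in> M" "rel_singular M c' \<kappa>" "rel_singular N (j c') (j \<kappa>)"
proof -
  have "sat N (Ex 0 fSingular) (j \<circ> env [\<kappa>, \<kappa>])"
    using assms by (auto simp: env_def sat_fSingular)
  then have "sat M (Ex 0 fSingular) (env [\<kappa>, \<kappa>])"
    using elem_env[of "[\<kappa>, \<kappa>]" "Ex 0 fSingular"] assms by simp
  then obtain c' where c': "c' \<in> M" "rel_singular M c' \<kappa>"
    by (auto simp: env_def sat_fSingular)
  moreover have "rel_singular N (j c') (j \<kappa>)"
    using elem_env[of "[c', \<kappa>]" fSingular] c' assms(3) by (simp add: env_def sat_fSingular)
  ultimately show thesis by (rule that)
qed

lemma reflect_avoids:
  assumes "C \<in> N" "rel_avoids N C (j \<kappa>) (j lam) (j D) (j g)" "{\<kappa>, lam, D, g} \<subseteq> M"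
  obtains C' where "C' \<in> M" "rel_avoids M C' \<kappa> lam D g"
    "rel_avoids N (j C') (j \<kappa>) (j lam) (j D) (j g)"
proof -
  have "sat N (Ex 0 fAvoids) (j \<circ> env [\<kappa>, \<kappa>, lam, D, g])"
    using assms by (auto simp: env_def sat_fAvoids)
  then have "sat M (Ex 0 fAvoids) (env [\<kappa>, \<kappa>, lam, D, g])"
    using elem_env[of "[\<kappa>, \<kappa>, lam, D, g]" "Ex 0 fAvoids"] assms by simp
  then obtain C' where C': "C' \<in> M" "rel_avoids M C' \<kappa> lam D g"
    by (auto simp: env_def sat_fAvoids)
  moreover have "rel_avoids N (j C') (j \<kappa>) (j lam) (j D) (j g)"
    using elem_env[of "[C', \<kappa>, lam, D, g]" fAvoids] C' assms(3) by (simp add: env_def sat_fAvoids)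
  ultimately show thesis by (rule that)
qed

end


section \<open>Critical points\<close>

locale critical_embedding = elementary +
  fixes \<mu>
  assumes mu_M: "\<mu> \<in> M" and mu_Ord: "Ord \<mu>" and mu_moved: "\<mu> \<in> elts (j \<mu>)"
    and mu_least: "\<And>\<beta>. \<beta> \<in> M \<Longrightarrow> Ord \<beta> \<Longrightarrow> \<beta> \<in> elts (j \<beta>) \<Longrightarrow> elts \<mu> \<subseteq> elts \<beta>"
begin

text \<open>For a membership-minimal counterexample \<open>x\<close>, applying \<open>j\<close> to \<open>j x \<in> x\<close> shows that \<open>j x\<close> is a
  counterexample, too.\<close>

lemma j_not_decreasing: "x \<in> M \<Longrightarrow> Ord x \<Longrightarrow> j x \<notin> elts x"
proof (induction x rule: mem_induct)
  case (step x)
  show ?case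
  proof
    assume dec: "j x \<in> elts x"
    then have "j x \<in> M" "Ord (j x)" using M_mem Ord_mem step.prems by blast+
    then show False using step.IH[OF dec] dec j_mem[of "j x" x] step.prems by blast
  qed
qed

lemma j_fix:
  assumes "\<xi> \<in> elts \<mu>"
  shows "j \<xi> = \<xi>"
proof -
  have \<xi>: "\<xi> \<in> M" "Ord \<xi>" using assms M_mem mu_M Ord_mem mu_Ord by blast+
  then have "\<xi> \<notin> elts (j \<xi>)" using mu_least[of \<xi>] assms mem_not_refl by blast
  moreover have "j \<xi> \<notin> elts \<xi>" using j_not_decreasing \<xi> by blast
  moreover have "Ord (j \<xi>)" using j_Ord \<xi> by simp
  ultimately show ?thesis using Ord_linear[OF \<xi>(2), of "j \<xi>"] by simp
qed

text \<open>If \<open>\<mu>\<close> were the successor of \<open>\<xi>\<close>, then \<open>j \<mu>\<close> would be the successor of \<open>j \<xi> = \<xi>\<close>, that is,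
  \<open>\<mu>\<close>. In the same way \<open>j\<close> fixes the empty set. So \<open>\<mu>\<close> is infinite, and a cardinal above it is
  uncountable.\<close>

lemma mu_limit:
  assumes "\<xi> \<in> elts \<mu>"
  shows "ord_succ \<xi> \<in> elts \<mu>"
proof (rule ccontr)
  assume "ord_succ \<xi> \<notin> elts \<mu>"
  then have "elts \<mu> \<subseteq> insert \<xi> (elts \<xi>)"
    using Ord_not_mem_iff[OF mu_Ord Ord_ord_succ] Ord_mem[OF mu_Ord assms] by simp
  then have eq: "elts \<mu> = insert \<xi> (elts \<xi>)" using assms Ord_subset[OF mu_Ord assms] by blast
  then have "elts (j \<mu>) = insert \<xi> (elts \<xi>)"
    using j_succ[of \<xi> \<mu>] M_mem[OF assms mu_M] mu_M j_fix[OF assms] by simp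
  then have "j \<mu> = \<mu>" using eq extensionality by blast
  then show False using mu_moved by simp
qed

lemma mu_infinite: "infinite (elts \<mu>)"
proof -
  have "numeral_of n \<in> elts \<mu>" for n
  proof (induction n)
    case 0
    have "elts \<mu> \<noteq> {}" using j_empty[OF mu_M] mu_moved by auto
    moreover have "Ord (vset {} :: 'a)" by (rule Ord_vset) (auto simp: transitive_class_def)
    ultimately show ?case using Ord_not_mem_iff[OF mu_Ord, of "vset {}"] by auto
  next
    case (Suc n)
    then show ?case using mu_limit by (simp add: ord_succ_def)
  qed
  then have "range numeral_of \<subseteq> elts \<mu>" by blast
  then show ?thesis using range_inj_infinite[OF inj_numeral_of] infinite_super by blast
qed

lemma uncountable_image:
  assumes "Card (j \<mu>)"
  shows "uncountable (elts (j \<mu>))"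
proof
  assume "countable (elts (j \<mu>))"
  then have "elts (j \<mu>) \<lesssim> (UNIV::nat set)" by (auto simp: countable_def lepoll_def)
  also have "(UNIV::nat set) \<lesssim> elts \<mu>" using mu_infinite by (simp add: infinite_le_lepoll)
  also have "elts \<mu> \<prec> elts (j \<mu>)" by (rule Card_lesspoll[OF assms mu_moved])
  finally show False by simp
qed

text \<open>Sets that have fewer than \<open>\<mu>\<close> members in the sense of \<open>M\<close> are mapped pointwise. If \<open>f\<close> enumerates
  \<open>c\<close> along \<open>\<gamma> < \<mu>\<close>, then \<open>j f\<close> enumerates \<open>j c\<close> along \<open>j \<gamma> = \<gamma>\<close>, and the value of \<open>j f\<close> at
  \<open>\<xi> = j \<xi>\<close> is the image of the value of \<open>f\<close> at \<open>\<xi>\<close>.\<close>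

lemma j_lt_card:
  assumes "c \<in> M" "rel_lt_card M c \<mu>"
  shows "elts (j c) \<subseteq> j ` elts c"
proof
  fix z assume z: "z \<in> elts (j c)"
  obtain \<gamma> f where \<gamma>: "\<gamma> \<in> elts \<mu>" "\<gamma> \<in> M" "f \<in> M" "rel_enum M c \<gamma> f"
    using assms(2) by (auto simp: rel_lt_card_def)
  then have enum: "rel_enum N (j c) \<gamma> (j f)"
    using j_rel_enum[of c \<gamma> f] assms(1) j_fix by simp
  have "z \<in> N" using z j_in[OF assms(1)] transitive_classD[OF trans_N] by blast
  then obtain \<xi> where \<xi>: "\<xi> \<in> elts \<gamma>" "rel_app N (j f) \<xi> z"
    using enum z unfolding rel_enum_def by blast
  have "\<xi> \<in> M" "j \<xi> = \<xi>" using \<xi>(1) \<gamma> M_mem j_fix Ord_trans[OF mu_Ord] by blast+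
  then obtain z' where z': "z' \<in> M" "z' \<in> elts c" "rel_app M f \<xi> z'"
    using reflect_app[of c f \<xi> z] assms(1) \<gamma>(3) \<open>z \<in> N\<close> z \<xi>(2) by auto
  then have "rel_app N (j f) \<xi> (j z')"
    using j_rel_app[of f \<xi> z'] \<gamma>(3) \<open>\<xi> \<in> M\<close> \<open>j \<xi> = \<xi>\<close> by simp
  then have "z = j z'"
    using enum \<xi>(2) \<open>z \<in> N\<close> j_in[OF z'(1)] j_in[OF \<open>\<xi> \<in> M\<close>] \<open>j \<xi> = \<xi>\<close>
    unfolding rel_enum_def by metis
  then show "z \<in> j ` elts c" using z'(2) by blast
qed

text \<open>A witness \<open>c'\<close> in \<open>M\<close> for the singularity of \<open>\<mu>\<close> is a subset of \<open>\<mu>\<close>, so \<open>j c' = c'\<close> by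
  pointwise mapping. But \<open>j c'\<close> is not bounded by \<open>\<mu> \<in> j \<mu>\<close>.\<close>

lemma not_singular:
  assumes "c \<in> N"
  shows "\<not> rel_singular N c (j \<mu>)"
proof
  assume "rel_singular N c (j \<mu>)"
  then obtain c' where c': "c' \<in> M" "rel_singular M c' \<mu>" "rel_singular N (j c') (j \<mu>)"
    using reflect_singular[OF assms _ mu_M] by blast
  have sub: "elts c' \<subseteq> elts \<mu>" "rel_lt_card M c' \<mu>"
    using c' rel_sub_abs[OF trans_M] by (auto simp: rel_singular_def)
  have "\<mu> \<in> N" using mu_moved j_in[OF mu_M] transitive_classD[OF trans_N] by blast
  then obtain z where z: "z \<in> elts (j c')" "z \<notin> elts \<mu>"
    using c'(3) mu_moved by (auto simp: rel_singular_def)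
  then obtain z' where "z' \<in> elts c'" "z = j z'" using j_lt_card[OF c'(1) sub(2)] by blast
  then show False using z sub(1) j_fix by auto
qed

end

lemma crit_eqI:
  assumes "\<mu> \<in> M" "Ord \<mu>" "\<mu> \<in> elts (j \<mu>)"
    and "\<And>\<beta>. \<beta> \<in> M \<Longrightarrow> Ord \<beta> \<Longrightarrow> \<beta> \<in> elts (j \<beta>) \<Longrightarrow> elts \<mu> \<subseteq> elts \<beta>"
  shows "crit M j = \<mu>"
  unfolding crit_def
proof (rule the_equality)
  fix \<alpha> assume \<alpha>: "\<alpha> \<in> M \<and> Ord \<alpha> \<and> \<alpha> \<in> elts (j \<alpha>) \<and>
    (\<forall>\<beta>\<in>M. Ord \<beta> \<and> \<beta> \<in> elts (j \<beta>) \<longrightarrow> elts \<alpha> \<subseteq> elts \<beta>)"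
  then have "elts \<mu> \<subseteq> elts \<alpha>" "elts \<alpha> \<subseteq> elts \<mu>" using assms by simp_all
  then show "\<alpha> = \<mu>" using extensionality by blast
qed (use assms in simp)

lemma small_embedding_critical:
  assumes "small_embedding \<kappa> \<theta> M j"
  obtains \<mu> where "critical_embedding (elts M) (H \<theta>) j \<mu>" "j \<mu> = \<kappa>"
proof -
  have el: "elementary (elts M) (H \<theta>) j"
    using assms transitive_class_H by (simp add: small_embedding_def elementary_def)
  obtain \<alpha> where "Ord \<alpha>" "\<alpha> \<in> elts M \<and> \<alpha> \<in> elts (j \<alpha>)"
    using assms by (auto simp: small_embedding_def nontrivial_def)
  then obtain \<mu> where \<mu>: "Ord \<mu>" "\<mu> \<in> elts M \<and> \<mu> \<in> elts (j \<mu>)"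
    "\<And>\<gamma>. Ord \<gamma> \<Longrightarrow> \<gamma> \<in> elts M \<and> \<gamma> \<in> elts (j \<gamma>) \<Longrightarrow> elts \<mu> \<subseteq> elts \<gamma>"
    using Ord_least[of \<alpha> "\<lambda>\<alpha>. \<alpha> \<in> elts M \<and> \<alpha> \<in> elts (j \<alpha>)"] by blast
  have "crit (elts M) j = \<mu>"
    by (rule crit_eqI) (use \<mu> in auto)
  then have "j \<mu> = \<kappa>" using assms by (simp add: small_embedding_def)
  moreover have "critical_embedding (elts M) (H \<theta>) j \<mu>"
    using el \<mu> by (simp add: critical_embedding_def critical_embedding_axioms_def)
  ultimately show thesis using that by blast
qed


section \<open>Sets that belong to H\<close>

text \<open>All objects attached to \<open>P_\<kappa>(lam)\<close> in the proof are subsets of the third power set of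
  \<open>lam\<close>: families of subsets of \<open>lam\<close>, and graphs of lists, whose elements are ordered pairs of
  subsets of \<open>lam\<close>.\<close>

definition pow3 :: "'v::zfc_universe \<Rightarrow> 'v" where
  "pow3 x = powset (powset (powset x))"

lemma transitive_powset:
  "transitive_class (elts x) \<Longrightarrow> transitive_class (elts (powset x))"
  by (auto simp: transitive_class_def)

lemma subset_powset: "transitive_class (elts x) \<Longrightarrow> elts x \<subseteq> elts (powset x)"
  by (auto simp: transitive_class_def)

lemma opair_in_powset: "a \<in> elts x \<Longrightarrow> b \<in> elts x \<Longrightarrow> opair a b \<in> elts (powset (powset x))"
  by (auto simp: opair_def)

lemma pow3_transitive: "Ord \<alpha> \<Longrightarrow> transitive_class (elts (pow3 \<alpha>))"
  by (simp only: pow3_def transitive_powset Ord_transitive)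

lemma powset_subset_pow3:
  assumes "Ord \<alpha>"
  shows "elts (powset \<alpha>) \<subseteq> elts (powset (powset \<alpha>))" "elts (powset (powset \<alpha>)) \<subseteq> elts (pow3 \<alpha>)"
  unfolding pow3_def using subset_powset transitive_powset Ord_transitive[OF assms] by blast+

lemma Ord_subset_pow3: "Ord \<alpha> \<Longrightarrow> elts \<alpha> \<subseteq> elts (pow3 \<alpha>)"
  using powset_subset_pow3[of \<alpha>] subset_powset[OF Ord_transitive[of \<alpha>]] by blast

lemma opair_in_pow3:
  assumes "Ord \<alpha>" "elts a \<subseteq> elts \<alpha>" "elts b \<subseteq> elts \<alpha>"
  shows "opair a b \<in> elts (pow3 \<alpha>)"
  unfolding pow3_def by (rule opair_in_powset) (use assms in auto)

lemma Pk_subset: "Pk \<kappa> lam \<subseteq> elts (powset lam)"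
  by (auto simp: Pk_def)

lemma small_Pk: "small (Pk \<kappa> lam)"
  using small_subset[OF small_elts Pk_subset] .

lemma fun_graph_list_in_H:
  assumes "Ord lam" "elts (pow3 lam) \<prec> elts \<theta>" "is_list (Pk \<kappa> lam) d"
  shows "fun_graph (Pk \<kappa> lam) d \<in> H \<theta>"
proof (rule subset_transitive_in_H[OF pow3_transitive[OF assms(1)] assms(2)])
  show "elts (fun_graph (Pk \<kappa> lam) d) \<subseteq> elts (pow3 lam)"
    unfolding elts_fun_graph[OF small_Pk]
  proof (rule image_subsetI)
    fix a assume a: "a \<in> Pk \<kappa> lam"
    then have "elts a \<subseteq> elts lam" by (simp add: Pk_def)
    moreover have "elts (d a) \<subseteq> elts a" using a assms(3) by (simp add: is_list_def)
    ultimately show "opair a (d a) \<in> elts (pow3 lam)"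
      by (intro opair_in_pow3[OF assms(1)]) auto
  qed
qed

lemma lt_card_in_H:
  assumes "Ord lam" "elts (pow3 lam) \<prec> elts \<theta>" "Ord \<kappa>" "elts \<kappa> \<subseteq> elts lam"
    and c: "elts c \<subseteq> elts lam" "elts c \<prec> elts \<kappa>"
  shows "rel_lt_card (H \<theta>) c \<kappa>"
proof -
  note inH = subset_transitive_in_H[OF pow3_transitive[OF assms(1)] assms(2)]
  note subs = Ord_subset_pow3[OF assms(1)]
  have H_elt: "x \<in> H \<theta>" if "x \<in> elts lam" for x
    using transitive_classD[OF transitive_class_H inH[OF subs] that] .
  obtain \<gamma> where \<gamma>: "\<gamma> \<in> elts \<kappa>" "elts \<gamma> \<approx> elts c"
    using lesspoll_eqpoll_Card[OF c(2) assms(3)] by metis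
  then obtain e where e: "bij_betw e (elts \<gamma>) (elts c)" by (auto simp: eqpoll_def)
  define f where "f = fun_graph (elts \<gamma>) e"
  have \<gamma>lam: "elts \<gamma> \<subseteq> elts lam" using Ord_subset assms(1,4) \<gamma>(1) by blast
  have "elts f \<subseteq> elts (powset (powset lam))"
    unfolding f_def elts_fun_graph[OF small_elts]
    using \<gamma>lam c(1) bij_betwE[OF e] by (intro image_subsetI opair_in_powset) auto
  then have f: "f \<in> H \<theta>" using inH powset_subset_pow3[OF assms(1)] by blast
  have app: "rel_app (H \<theta>) f \<xi> z \<longleftrightarrow> \<xi> \<in> elts \<gamma> \<and> z = e \<xi>" if "\<xi> \<in> H \<theta>" "z \<in> H \<theta>" for \<xi> z
    using rel_app_abs[OF transitive_class_H f that] by (auto simp: f_def)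
  have "rel_enum (H \<theta>) c \<gamma> f"
    unfolding rel_enum_def
  proof (intro conjI ballI impI)
    fix z assume "z \<in> H \<theta>" "z \<in> elts c"
    then obtain \<xi> where "\<xi> \<in> elts \<gamma>" "z = e \<xi>" using bij_betw_imp_surj_on[OF e] by blast
    then show "\<exists>\<xi>\<in>H \<theta>. \<xi> \<in> elts \<gamma> \<and> rel_app (H \<theta>) f \<xi> z"
      using app H_elt \<gamma>lam \<open>z \<in> H \<theta>\<close> by blast
  qed (use app in auto)
  moreover have "\<gamma> \<in> H \<theta>" using H_elt \<gamma>(1) assms(4) by blast
  ultimately show ?thesis unfolding rel_lt_card_def using \<gamma>(1) f by blast
qed


section \<open>Closure under directed unions\<close>

lemma directed_finite_bound:
  assumes "B \<noteq> {}" "\<And>x y. x \<in> B \<Longrightarrow> y \<in> B \<Longrightarrow> \<exists>z\<in>B. elts x \<subseteq> elts z \<and> elts y \<subseteq> elts z"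
    and "finite Y" "Y \<subseteq> B"
  shows "\<exists>z\<in>B. \<forall>y\<in>Y. elts y \<subseteq> elts z"
  using assms(3,4)
proof (induction rule: finite_induct)
  case empty
  then show ?case using assms(1) by blast
next
  case (insert y Y)
  then obtain z where "z \<in> B" "\<forall>y\<in>Y. elts y \<subseteq> elts z" by blast
  moreover obtain w where "w \<in> B" "elts y \<subseteq> elts w" "elts z \<subseteq> elts w"
    using assms(2) insert.prems calculation(1) by blast
  ultimately show ?case by blast
qed

text \<open>Closure under increasing sequences implies closure under directed unions of size less than \<open>\<kappa>\<close>.
  Choose by recursion on finite sets \<open>e \<subseteq> b\<close> members \<open>F e \<supseteq> e\<close> of \<open>B\<close> that increase with \<open>e\<close>, and
  let \<open>G a\<close> be the union of all \<open>F e\<close> for finite \<open>e \<subseteq> a\<close>. By induction on the cardinality of \<open>a\<close>,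
  \<open>G a\<close> belongs to \<open>C\<close>: for finite \<open>a\<close> it is \<open>F a\<close>, and for infinite \<open>a\<close>, enumerated along a cardinal
  \<open>\<nu> < \<kappa>\<close>, it is the increasing union of the \<open>G a'\<close> for the images \<open>a'\<close> of the \<open>\<xi> < \<nu>\<close>. Finally
  \<open>G b = b\<close>.\<close>

lemma closed_Pk_directed:
  fixes \<kappa> :: "'v::zfc_universe"
  assumes \<kappa>: "Card \<kappa>" and closed: "closed_Pk \<kappa> C" and B: "B \<subseteq> C" "B \<noteq> {}"
    and dir: "\<And>x y. x \<in> B \<Longrightarrow> y \<in> B \<Longrightarrow> \<exists>z\<in>B. elts x \<subseteq> elts z \<and> elts y \<subseteq> elts z"
    and b: "elts b = (\<Union>x\<in>B. elts x)" "elts b \<prec> elts \<kappa>"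
  shows "b \<in> C"
proof -
  obtain p where p: "\<And>x. x \<in> elts b \<Longrightarrow> p x \<in> B \<and> x \<in> elts (p x)"
    using b(1) by (metis UN_iff)
  define Q where "Q F e c \<longleftrightarrow> c \<in> B \<and> e \<subseteq> elts c \<and> (\<forall>e'\<subset>e. elts (F e') \<subseteq> elts c)"
    for F :: "'v set \<Rightarrow> 'v" and e c
  define F where "F = wfrec finite_psubset (\<lambda>F e. SOME c. Q F e c)"
  have F_eq: "F e = (SOME c. Q F e c)" if "finite e" for e
  proof -
    have "F e = (SOME c. Q (cut F finite_psubset e) e c)"
      unfolding F_def by (subst wfrec[OF wf_finite_psubset]) simp
    moreover have "Q (cut F finite_psubset e) e = Q F e"
      using that by (auto simp: Q_def fun_eq_iff cut_apply finite_psubset_def)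
    ultimately show ?thesis by simp
  qed
  have QF: "Q F e (F e)" if "finite e" "e \<subseteq> elts b" for e
    using that
  proof (induction e rule: finite_psubset_induct)
    case (psubset e)
    \<comment> \<open>The finitely many members of \<open>B\<close> that \<open>F e\<close> has to include.\<close>
    define Y where "Y = F ` {e'. e' \<subset> e} \<union> p ` e"
    have "F e' \<in> B" if "e' \<subset> e" for e'
      using psubset that unfolding Q_def by (meson dual_order.trans psubset_imp_subset)
    moreover have "finite {e'. e' \<subset> e}"
      using psubset.hyps(1) by (rule finite_subset[rotated, OF finite_Pow_iff[THEN iffD2]]) auto
    ultimately have "finite Y" "Y \<subseteq> B" using psubset p by (auto simp: Y_def)
    then obtain z where z: "z \<in> B" "\<forall>y\<in>Y. elts y \<subseteq> elts z"
      using directed_finite_bound[OF B(2) dir, of Y] by metis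
    have "e \<subseteq> elts z"
    proof
      fix x assume "x \<in> e"
      then have "x \<in> elts (p x)" "p x \<in> Y" using p psubset.prems by (auto simp: Y_def)
      then show "x \<in> elts z" using z(2) by blast
    qed
    then have "Q F e z" using z by (auto simp: Q_def Y_def)
    then show ?case unfolding F_eq[OF psubset.hyps(1)] by (rule someI)
  qed
  have F_B: "F e \<in> B" and F_sup: "e \<subseteq> elts (F e)" if "finite e" "e \<subseteq> elts b" for e
    using QF[OF that] by (auto simp: Q_def)
  have F_mono: "elts (F e') \<subseteq> elts (F e)" if "finite e" "e \<subseteq> elts b" "e' \<subseteq> e" for e e'
  proof (cases "e' = e")
    case False
    then have "e' \<subset> e" using that(3) by blast
    then show ?thesis using QF[OF that(1,2)] unfolding Q_def by blast
  qed simp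
  define G where "G a = (\<Union>e\<in>{e. finite e \<and> e \<subseteq> a}. elts (F e))" for a
  have G_mono: "a \<subseteq> a' \<Longrightarrow> G a \<subseteq> G a'" for a a' by (auto simp: G_def)
  have G_b: "G a \<subseteq> elts b" if "a \<subseteq> elts b" for a
    using that F_B b(1) unfolding G_def by blast
  have G_small: "small (G a)" if "a \<subseteq> elts b" for a
    using small_subset[OF small_elts G_b[OF that]] .
  have G_in: "vset (G a) \<in> C" if "Card \<nu>" "\<nu> \<in> elts \<kappa>" "a \<subseteq> elts b" "elts \<nu> \<approx> a" for \<nu> a
    using that
  proof (induction \<nu> arbitrary: a rule: mem_induct)
    case (step \<nu>)
    show ?case
    proof (cases "finite a")
      case True
      then have "G a = elts (F a)"
        unfolding G_def using F_mono[OF True step.prems(3)]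
        by (intro equalityI UN_least UN_upper) (auto simp: True)
      then show ?thesis using F_B[OF True step.prems(3)] B(1) by auto
    next
      case False
      obtain h where h: "bij_betw h (elts \<nu>) a" using step.prems(4) by (auto simp: eqpoll_def)
      have inf: "infinite (elts \<nu>)" using False h bij_betw_finite by blast
      have ord: "Ord \<nu>" using step.prems(1) Card_Ord by blast
      define x where "x \<xi> = vset (G (h ` elts \<xi>))" for \<xi>
      have sub: "h ` elts \<xi> \<subseteq> elts b" if "\<xi> \<in> elts \<nu>" for \<xi>
        using Ord_subset[OF ord that] h step.prems(3) by (auto simp: bij_betw_def)
      have elts_x: "elts (x \<xi>) = G (h ` elts \<xi>)" if "\<xi> \<in> elts \<nu>" for \<xi>
        unfolding x_def using G_small[OF sub[OF that]] by simp
      have x_in: "x \<xi> \<in> C" if "\<xi> \<in> elts \<nu>" for \<xi>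
      proof -
        have "h ` elts \<xi> \<prec> elts \<nu>"
          using image_lepoll Card_lesspoll[OF step.prems(1) that] by (rule lesspoll_trans1)
        then obtain \<nu>' where "\<nu>' \<in> elts \<nu>" "Card \<nu>'" "elts \<nu>' \<approx> h ` elts \<xi>"
          using lesspoll_eqpoll_Card[OF _ ord] by metis
        moreover have "\<nu>' \<in> elts \<kappa>"
          using calculation Ord_trans[OF Card_Ord[OF \<kappa>] step.prems(2)] by blast
        ultimately show ?thesis unfolding x_def using step.IH sub[OF that] by blast
      qed
      have x_mono: "elts (x \<xi>) \<subseteq> elts (x \<eta>)" if "\<eta> \<in> elts \<nu>" "\<xi> \<in> elts \<eta>" for \<eta> \<xi>
      proof -
        have "\<xi> \<in> elts \<nu>" using Ord_trans[OF ord that] .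
        moreover have "elts \<xi> \<subseteq> elts \<eta>" using Ord_subset Ord_mem ord that by blast
        ultimately show ?thesis using elts_x that(1) G_mono image_mono by metis
      qed
      have "vset (\<Union>\<xi>\<in>elts \<nu>. elts (x \<xi>)) \<in> C"
        using closed step.prems(2) x_in x_mono inf unfolding closed_Pk_def
        by (metis (no_types, lifting) finite.emptyI image_subsetI)
      moreover have "(\<Union>\<xi>\<in>elts \<nu>. elts (x \<xi>)) = G a"
      proof
        show "(\<Union>\<xi>\<in>elts \<nu>. elts (x \<xi>)) \<subseteq> G a"
        proof (rule UN_least)
          fix \<xi> assume \<xi>: "\<xi> \<in> elts \<nu>"
          have "h ` elts \<xi> \<subseteq> a" using Ord_subset[OF ord \<xi>] h by (auto simp: bij_betw_def)
          then show "elts (x \<xi>) \<subseteq> G a" unfolding elts_x[OF \<xi>] by (rule G_mono)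
        qed
        show "G a \<subseteq> (\<Union>\<xi>\<in>elts \<nu>. elts (x \<xi>))"
        proof
          fix y assume "y \<in> G a"
          then obtain e where e: "finite e" "e \<subseteq> a" "y \<in> elts (F e)" by (auto simp: G_def)
          \<comment> \<open>A finite subset of the limit ordinal \<open>\<nu>\<close> is bounded in it.\<close>
          have bound: "\<exists>\<xi>\<in>elts \<nu>. e \<subseteq> h ` elts \<xi>" using e(1,2)
          proof (induction rule: finite_induct)
            case empty
            then show ?case using inf by (metis empty_subsetI ex_in_conv finite.emptyI)
          next
            case (insert z e)
            then obtain \<xi> where \<xi>: "\<xi> \<in> elts \<nu>" "e \<subseteq> h ` elts \<xi>" by blast
            obtain \<zeta> where \<zeta>: "\<zeta> \<in> elts \<nu>" "z = h \<zeta>"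
              using insert.prems h by (auto simp: bij_betw_def)
            have succ: "ord_succ \<zeta> \<in> elts \<nu>" using Card_infinite_limit[OF step.prems(1) inf \<zeta>(1)] .
            have "Ord \<xi>" "Ord (ord_succ \<zeta>)" using Ord_mem[OF ord] \<xi>(1) succ by blast+
            then consider "elts \<xi> \<subseteq> elts (ord_succ \<zeta>)" | "elts (ord_succ \<zeta>) \<subseteq> elts \<xi>"
              using Ord_linear Ord_subset by blast
            then show ?case
            proof cases
              case 1
              then have "insert z e \<subseteq> h ` elts (ord_succ \<zeta>)" using \<xi>(2) \<zeta>(2) by auto
              then show ?thesis using succ by blast
            next
              case 2
              then have "insert z e \<subseteq> h ` elts \<xi>" using \<xi>(2) \<zeta>(2) by auto
              then show ?thesis using \<xi>(1) by blast
            qed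
          qed
          then obtain \<xi> where \<xi>: "\<xi> \<in> elts \<nu>" "e \<subseteq> h ` elts \<xi>" by blast
          then have "y \<in> elts (x \<xi>)" using e elts_x[OF \<xi>(1)] by (auto simp: G_def)
          then show "y \<in> (\<Union>\<xi>\<in>elts \<nu>. elts (x \<xi>))" using \<xi>(1) by blast
        qed
      qed
      ultimately show ?thesis by simp
    qed
  qed
  obtain \<nu> where \<nu>: "\<nu> \<in> elts \<kappa>" "Card \<nu>" "elts \<nu> \<approx> elts b"
    using lesspoll_eqpoll_Card[OF b(2) Card_Ord[OF \<kappa>]] .
  have "elts b \<subseteq> G (elts b)"
  proof
    fix x assume "x \<in> elts b"
    then have "x \<in> elts (F {x})" using F_sup[of "{x}"] by blast
    then show "x \<in> G (elts b)"
      using \<open>x \<in> elts b\<close> unfolding G_def by (intro UN_I[of "{x}"]) simp_all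
  qed
  then have "G (elts b) = elts b" using G_b by blast
  then show ?thesis using G_in[OF \<nu>(2,1) _ \<nu>(3)] by simp
qed


section \<open>From small embeddings to ineffability\<close>

text \<open>A set \<open>X\<close> of fewer than \<open>\<kappa>\<close> ordinals that is unbounded in \<open>\<kappa>\<close>, together with an enumeration of it,
  belongs to \<open>H \<theta>\<close>, and there it contradicts \<open>not_singular\<close>.\<close>

lemma critical_point_regular:
  fixes \<kappa> lam :: "'v::zfc_universe"
  assumes \<kappa>: "Card \<kappa>" and lam: "Ord lam" "elts \<kappa> \<subseteq> elts lam" "elts (pow3 lam) \<prec> elts \<theta>"
    and emb: "small_embedding \<kappa> \<theta> M j"
  shows "regular_cardinal \<kappa> \<and> uncountable (elts \<kappa>)"
proof -
  obtain \<mu> where "critical_embedding (elts M) (H \<theta>) j \<mu>" and [simp]: "j \<mu> = \<kappa>"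
    using small_embedding_critical[OF emb] .
  then interpret critical_embedding "elts M" "H \<theta>" j \<mu> by simp
  have unc: "uncountable (elts \<kappa>)" using uncountable_image \<kappa> by simp
  have "\<exists>\<beta>\<in>elts \<kappa>. X \<subseteq> elts \<beta>" if X: "X \<subseteq> elts \<kappa>" "X \<prec> elts \<kappa>" for X
  proof (rule ccontr)
    assume unb: "\<not> ?thesis"
    have sm: "small X" using small_subset[OF small_elts X(1)] .
    have c: "vset X \<in> H \<theta>"
      using H_subset_closed[OF j_in[OF mu_M], of "vset X"] X(1) sm by simp
    have "rel_singular (H \<theta>) (vset X) \<kappa>"
      unfolding rel_singular_def
    proof (intro conjI ballI impI)
      show "rel_sub (H \<theta>) (vset X) \<kappa>" using X(1) sm by (auto simp: rel_sub_def)
      show "rel_lt_card (H \<theta>) (vset X) \<kappa>"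
        using X lam sm \<kappa> by (intro lt_card_in_H[of lam]) (auto simp: Card_Ord)
      fix \<beta> assume "\<beta> \<in> elts \<kappa>"
      then obtain z where "z \<in> X" "z \<notin> elts \<beta>" using unb by blast
      then show "\<exists>z\<in>H \<theta>. z \<in> elts (vset X) \<and> z \<notin> elts \<beta>"
        using transitive_classD[OF transitive_class_H c] sm by auto
    qed
    then show False using not_singular[OF c] by simp
  qed
  then show ?thesis using \<kappa> unc uncountable_infinite by (auto simp: regular_cardinal_def)
qed

text \<open>Let \<open>b = j[\<delta>]\<close> and let \<open>D = j(D0)\<close>, where \<open>D0 \<in> M\<close> is the preimage of \<open>d b\<close>; then
  \<open>d b = D \<inter> b\<close>. Suppose that a club \<open>C\<close> avoids the set \<open>S\<close> of all such sets. This is reflected to some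
  \<open>C0 \<in> M\<close>. The members \<open>c\<close> of \<open>C0\<close> have fewer than \<open>\<mu>\<close> members in the sense of \<open>M\<close>, so
  \<open>j c = j[c] \<subseteq> b\<close>; since \<open>C0\<close> covers \<open>\<delta>\<close>, \<open>B = j[C0]\<close> is a directed subfamily of \<open>j C0\<close> with union \<open>b\<close>. As \<open>j C0\<close> has the reflected property
  in \<open>H \<theta>\<close>, this yields \<open>d b \<noteq> D \<inter> b\<close>. The family \<open>B\<close> may have
  \<open>\<kappa>\<close> or more members; it is its union that has fewer than \<open>\<kappa>\<close>.\<close>

lemma embedding_imp_stationary:
  fixes \<kappa> lam :: "'v::zfc_universe"
  assumes \<kappa>: "regular_cardinal \<kappa>"
    and lam: "Ord lam" "elts \<kappa> \<subseteq> elts lam" "elts (pow3 lam) \<prec> elts \<theta>"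
    and d: "is_list (Pk \<kappa> lam) d"
    and emb: "small_embedding \<kappa> \<theta> M j"
    and \<delta>: "\<delta> \<in> elts M" "\<delta> \<in> elts \<kappa>" "j \<delta> = lam"
    and graph: "fun_graph (Pk \<kappa> lam) d \<in> j ` elts M"
    and pre: "vset (j -` elts (d (vset (j ` elts \<delta>))) \<inter> elts M) \<in> elts M" (is "?D0 \<in> _")
  shows "elts (j ?D0) \<subseteq> elts lam \<and>
    stationary_Pk \<kappa> lam {a \<in> Pk \<kappa> lam. elts (d a) = elts (j ?D0) \<inter> elts a}"
proof -
  obtain \<mu> where "critical_embedding (elts M) (H \<theta>) j \<mu>" and j_mu: "j \<mu> = \<kappa>"
    using small_embedding_critical[OF emb] .
  then interpret critical_embedding "elts M" "H \<theta>" j \<mu> by simp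
  have H_mem: "y \<in> H \<theta>" if "y \<in> elts x" "x \<in> H \<theta>" for x y
    using transitive_classD[OF transitive_class_H that(2,1)] .
  have card: "Card \<kappa>" using \<kappa> by (simp add: regular_cardinal_def)
  define b where "b = vset (j ` elts \<delta>)"
  have elts_b: "elts b = j ` elts \<delta>" by (simp add: b_def)
  have \<delta>M: "x \<in> elts M" if "x \<in> elts \<delta>" for x using M_mem[OF that \<delta>(1)] .
  have b_lam: "elts b \<subseteq> elts lam"
    using j_mem \<delta>M \<delta>(1,3) unfolding elts_b by (metis image_subsetI)
  have "elts b \<prec> elts \<kappa>"
    unfolding elts_b using image_lepoll Card_lesspoll[OF card \<delta>(2)] by (rule lesspoll_trans1)
  with b_lam have b: "b \<in> Pk \<kappa> lam" by (simp add: Pk_def)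
  define D0 where "D0 = ?D0"
  have D0M: "D0 \<in> elts M" using pre by (simp add: D0_def)
  have "small (j -` elts (d b) \<inter> elts M)" by (rule small_subset[OF small_elts]) auto
  then have elts_D0: "elts D0 = j -` elts (d b) \<inter> elts M"
    unfolding D0_def b_def by (rule elts_vset)
  define D where "D = j D0"
  have db: "elts (d b) \<subseteq> elts b" using d b by (simp add: is_list_def)
  have "elts D0 \<subseteq> elts \<delta>"
  proof
    fix x assume "x \<in> elts D0"
    then have x: "x \<in> elts M" "j x \<in> j ` elts \<delta>" using elts_D0 db elts_b by auto
    then obtain y where "y \<in> elts \<delta>" "j x = j y" by blast
    then show "x \<in> elts \<delta>" using j_eq[OF x(1) \<delta>M] by simp
  qed
  then have D_lam: "elts D \<subseteq> elts lam"
    using j_subset[OF D0M \<delta>(1)] \<delta>(3) by (simp add: D_def)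
  have D_b: "elts (d b) = elts D \<inter> elts b"
  proof
    show "elts (d b) \<subseteq> elts D \<inter> elts b"
    proof
      fix z assume z: "z \<in> elts (d b)"
      then obtain x where x: "x \<in> elts \<delta>" "z = j x" using db elts_b by blast
      then have "x \<in> elts D0" using z elts_D0 \<delta>M by auto
      then show "z \<in> elts D \<inter> elts b" using x j_mem[OF \<delta>M D0M] elts_b by (auto simp: D_def)
    qed
    show "elts D \<inter> elts b \<subseteq> elts (d b)"
    proof
      fix z assume z: "z \<in> elts D \<inter> elts b"
      then obtain x where x: "x \<in> elts \<delta>" "z = j x" using elts_b by blast
      then have "x \<in> elts D0" using z j_mem[OF \<delta>M D0M] by (auto simp: D_def)
      then show "z \<in> elts (d b)" using x elts_D0 by auto
    qed
  qed
  define S where "S = {a \<in> Pk \<kappa> lam. elts (d a) = elts D \<inter> elts a}"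
  obtain g where g: "g \<in> elts M" "j g = fun_graph (Pk \<kappa> lam) d" using graph by auto
  have app: "rel_app (H \<theta>) (j g) a y \<longleftrightarrow> a \<in> Pk \<kappa> lam \<and> y = d a"
    if "a \<in> H \<theta>" "y \<in> H \<theta>" for a y
    using rel_app_abs[OF trans_N j_in[OF g(1)] that] by (auto simp: g(2) small_Pk)
  have lamH: "lam \<in> H \<theta>" using j_in[OF \<delta>(1)] \<delta>(3) by simp
  have bH: "b \<in> H \<theta>" using H_subset_closed[OF lamH b_lam] .
  have dbH: "d b \<in> H \<theta>" using H_subset_closed[OF bH db] .
  have "S \<inter> C \<noteq> {}" if club: "club_Pk \<kappa> lam C" for C
  proof
    assume disj: "S \<inter> C = {}"
    have C: "C \<subseteq> Pk \<kappa> lam" and unb: "\<And>a. a \<in> Pk \<kappa> lam \<Longrightarrow> \<exists>c\<in>C. elts a \<subseteq> elts c"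
      and closed: "closed_Pk \<kappa> C"
      using club by (auto simp: club_Pk_def unbounded_Pk_def)
    have smC: "small C" using small_subset[OF small_Pk C] .
    have "elts (vset C) \<subseteq> elts (pow3 lam)"
      using smC C Pk_subset powset_subset_pow3[OF lam(1)] by fastforce
    then have CH: "vset C \<in> H \<theta>"
      by (rule subset_transitive_in_H[OF pow3_transitive[OF lam(1)] lam(3)])
    have memC: "c \<in> H \<theta>" "elts c \<subseteq> elts lam" "elts c \<prec> elts \<kappa>" if "c \<in> C" for c
      using H_mem[OF _ CH] smC that C by (auto simp: Pk_def)
    have avoids: "rel_avoids (H \<theta>) (vset C) (j \<mu>) (j \<delta>) (j D0) (j g)"
      unfolding rel_avoids_def j_mu \<delta>(3)
    proof (intro conjI ballI impI)
      have "\<exists>z\<in>C. elts x \<subseteq> elts z \<and> elts y \<subseteq> elts z" if "x \<in> C" "y \<in> C" for x y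
      proof -
        have "vset (elts x \<union> elts y) \<in> Pk \<kappa> lam"
          using memC[OF that(1)] memC[OF that(2)] regular_Un[OF \<kappa>] by (simp add: Pk_def)
        from unb[OF this] show ?thesis by simp
      qed
      then show "rel_directed (H \<theta>) (vset C)"
        using rel_directed_abs[OF trans_N CH] smC unb[OF b] by auto
    next
      fix x assume "x \<in> elts lam"
      moreover have "{x} \<prec> elts \<kappa>"
        using \<kappa> by (simp add: regular_cardinal_def finite_lesspoll_infinite)
      ultimately have "vset {x} \<in> Pk \<kappa> lam" by (simp add: Pk_def)
      then obtain c where "c \<in> C" "x \<in> elts c" using unb[of "vset {x}"] by auto
      then show "\<exists>c\<in>H \<theta>. c \<in> elts (vset C) \<and> x \<in> elts c" using memC smC by auto
    next
      fix c assume "c \<in> elts (vset C)"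
      then have "c \<in> C" using smC by simp
      then show "rel_sub (H \<theta>) c lam" "rel_lt_card (H \<theta>) c \<kappa>"
        using memC[of c] lt_card_in_H[OF lam(1,3) Card_Ord[OF card] lam(2)]
        by (auto simp: rel_sub_def)
    next
      fix B a y assume B: "B \<in> H \<theta>" and a: "a \<in> H \<theta>" and y: "y \<in> H \<theta>"
        and *: "rel_sub (H \<theta>) B (vset C) \<and> rel_directed (H \<theta>) B \<and>
          (\<forall>z\<in>H \<theta>. (z \<in> elts a) = (\<exists>c\<in>H \<theta>. c \<in> elts B \<and> z \<in> elts c)) \<and>
          rel_app (H \<theta>) (j g) a y"
      have BC: "elts B \<subseteq> C" using * rel_sub_abs[OF trans_N B] smC by simp
      have un: "elts a = (\<Union>x\<in>elts B. elts x)"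
        using * H_mem[OF _ a] H_mem[OF _ B] H_mem by blast
      have aP: "a \<in> Pk \<kappa> lam" "y = d a" using * app[OF a y] by auto
      have dirB: "elts B \<noteq> {}"
        "\<And>x y. x \<in> elts B \<Longrightarrow> y \<in> elts B \<Longrightarrow> \<exists>z\<in>elts B. elts x \<subseteq> elts z \<and> elts y \<subseteq> elts z"
        using * rel_directed_abs[OF trans_N B] by auto
      have "a \<in> C"
        using closed_Pk_directed[OF card closed BC dirB un] aP(1) by (simp add: Pk_def)
      then have "elts (d a) \<noteq> elts D \<inter> elts a" using disj aP(1) by (auto simp: S_def)
      then show "\<not> (\<forall>z\<in>H \<theta>. (z \<in> elts y) = (z \<in> elts a \<and> z \<in> elts (j D0)))"
        using H_mem[OF _ a] H_mem[OF _ y] aP(2) unfolding D_def by blast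
    qed
    obtain C0 where C0: "C0 \<in> elts M" "rel_avoids (elts M) C0 \<mu> \<delta> D0 g"
      and avoids': "rel_avoids (H \<theta>) (j C0) (j \<mu>) (j \<delta>) (j D0) (j g)"
      using reflect_avoids[OF CH avoids] mu_M \<delta>(1) D0M g(1) by auto
    have C0M: "c \<in> elts M" if "c \<in> elts C0" for c using M_mem[OF that C0(1)] .
    define B where "B = vset (j ` elts C0)"
    have elts_B: "elts B = j ` elts C0" by (simp add: B_def)
    have B_sub: "elts B \<subseteq> elts (j C0)" using j_mem[OF C0M C0(1)] elts_B by auto
    have BH: "B \<in> H \<theta>" using H_subset_closed[OF j_in[OF C0(1)] B_sub] .
    have "rel_directed (H \<theta>) B"
    proof -
      have "rel_directed (elts M) C0" using C0(2) by (simp add: rel_avoids_def)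
      then have dir0: "elts C0 \<noteq> {}"
        "\<And>x y. x \<in> elts C0 \<Longrightarrow> y \<in> elts C0 \<Longrightarrow> \<exists>z\<in>elts C0. elts x \<subseteq> elts z \<and> elts y \<subseteq> elts z"
        using rel_directed_abs[OF trans_M C0(1)] by auto
      have "\<exists>z\<in>elts C0. elts (j x) \<subseteq> elts (j z) \<and> elts (j y) \<subseteq> elts (j z)"
        if "x \<in> elts C0" "y \<in> elts C0" for x y
        using dir0(2)[OF that] j_subset C0M that by meson
      then show ?thesis
        unfolding rel_directed_abs[OF trans_N BH] elts_B using dir0(1) by auto
    qed
    moreover have "rel_sub (H \<theta>) B (j C0)" using B_sub by (auto simp: rel_sub_def)
    moreover have "(z \<in> elts b) = (\<exists>c\<in>H \<theta>. c \<in> elts B \<and> z \<in> elts c)" for z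
    proof
      assume "z \<in> elts b"
      then obtain x where x: "x \<in> elts \<delta>" "z = j x" using elts_b by blast
      then obtain c where "c \<in> elts C0" "x \<in> elts c"
        using C0(2) \<delta>M unfolding rel_avoids_def by meson
      then show "\<exists>c\<in>H \<theta>. c \<in> elts B \<and> z \<in> elts c"
        using j_mem[OF \<delta>M[OF x(1)] C0M] j_in[OF C0M] elts_B x(2) by blast
    next
      assume "\<exists>c\<in>H \<theta>. c \<in> elts B \<and> z \<in> elts c"
      then obtain c where c: "c \<in> elts C0" "z \<in> elts (j c)" unfolding elts_B by auto
      have cM: "c \<in> elts M" using C0M[OF c(1)] .
      then have "rel_sub (elts M) c \<delta>" "rel_lt_card (elts M) c \<mu>"
        using C0(2) c(1) unfolding rel_avoids_def by blast+
      then have "elts c \<subseteq> elts \<delta>" "elts (j c) \<subseteq> j ` elts c"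
        using rel_sub_abs[OF trans_M cM] j_lt_card[OF cM] by auto
      then have "elts (j c) \<subseteq> j ` elts \<delta>" using image_mono subset_trans by metis
      then show "z \<in> elts b" using c(2) unfolding elts_b by (rule subsetD)
    qed
    moreover have "rel_app (H \<theta>) (j g) b (d b)" using app[OF bH dbH] b by simp
    ultimately have "\<not> (\<forall>z\<in>H \<theta>. z \<in> elts (d b) \<longleftrightarrow> z \<in> elts b \<and> z \<in> elts (j D0))"
      using avoids' BH bH dbH unfolding rel_avoids_def by blast
    then show False using D_b by (auto simp: D_def)
  qed
  then have "stationary_Pk \<kappa> lam S" by (auto simp: stationary_Pk_def S_def)
  then show ?thesis using D_lam by (simp add: S_def D_def D0_def)
qed


section \<open>Skolem hulls\<close>

instance fm :: countable
  by countable_datatype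

text \<open>A number above all variables of a formula, so that satisfaction depends on finitely many values
  of an assignment and Skolem functions may take lists as arguments.\<close>

primrec var_bound :: "fm \<Rightarrow> nat" where
  "var_bound (Mem m n) = Suc (max m n)"
| "var_bound (Eq m n) = Suc (max m n)"
| "var_bound (Neg p) = var_bound p"
| "var_bound (Conj p q) = max (var_bound p) (var_bound q)"
| "var_bound (Ex n p) = max (Suc n) (var_bound p)"

lemma sat_cong:
  "(\<And>i. i < var_bound p \<Longrightarrow> s i = t i) \<Longrightarrow> sat A p s \<longleftrightarrow> sat A p t"
proof (induction p arbitrary: s t)
  case (Ex n p)
  have "sat A p (s(n := x)) \<longleftrightarrow> sat A p (t(n := x))" for x
    using Ex.prems by (intro Ex.IH) auto
  then show ?case by simp
next
  case (Conj p q)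
  have "sat A p s \<longleftrightarrow> sat A p t" "sat A q s \<longleftrightarrow> sat A q t"
    using Conj.prems by (auto intro!: Conj.IH)
  then show ?case by simp
next
  case (Neg p)
  have "sat A p s \<longleftrightarrow> sat A p t" using Neg.prems by (auto intro!: Neg.IH)
  then show ?case by simp
qed auto

definition skolem :: "'v::zfc_universe set \<Rightarrow> fm \<Rightarrow> nat \<Rightarrow> 'v list \<Rightarrow> 'v" where
  "skolem N p n xs = (SOME x. x \<in> N \<and> sat N p ((\<lambda>i. xs ! i)(n := x)))"

text \<open>One round of applying all Skolem functions. The restriction to \<open>N\<close> discards the arbitrary
  values of \<open>skolem\<close> where there is no witness.\<close>

definition hull_step :: "'v::zfc_universe set \<Rightarrow> 'v set \<Rightarrow> 'v set" where
  "hull_step N A = A \<union> {x \<in> N. \<exists>p n xs. set xs \<subseteq> A \<and> x = skolem N p n xs}"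

definition hull :: "'v::zfc_universe set \<Rightarrow> 'v set \<Rightarrow> 'v set" where
  "hull N A = (\<Union>k. (hull_step N ^^ k) A)"

lemma subset_hull: "A \<subseteq> hull N A"
  using UN_upper[of 0 UNIV "\<lambda>k. (hull_step N ^^ k) A"] by (simp add: hull_def)

lemma hull_subset:
  assumes "A \<subseteq> N"
  shows "hull N A \<subseteq> N"
proof -
  have "(hull_step N ^^ k) A \<subseteq> N" for k
    by (induction k) (use assms in \<open>auto simp: hull_step_def\<close>)
  then show ?thesis by (auto simp: hull_def)
qed

lemma directed_finite_subset:
  assumes "I \<noteq> {}" "\<And>i j. i \<in> I \<Longrightarrow> j \<in> I \<Longrightarrow> \<exists>k\<in>I. A i \<subseteq> A k \<and> A j \<subseteq> A k"
    and "finite Y" "Y \<subseteq> (\<Union>i\<in>I. A i)"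
  shows "\<exists>i\<in>I. Y \<subseteq> A i"
  using assms(3,4)
proof (induction rule: finite_induct)
  case empty
  then show ?case using assms(1) by blast
next
  case (insert y Y)
  then obtain i j where ij: "i \<in> I" "Y \<subseteq> A i" "j \<in> I" "y \<in> A j" by blast
  then obtain k where "k \<in> I" "A i \<subseteq> A k" "A j \<subseteq> A k" using assms(2) by blast
  then show ?case using ij by blast
qed

lemma hull_step_mono: "A \<subseteq> B \<Longrightarrow> hull_step N A \<subseteq> hull_step N B"
  unfolding hull_step_def by blast

lemma hull_step_directed_UN:
  assumes "I \<noteq> {}" "\<And>i j. i \<in> I \<Longrightarrow> j \<in> I \<Longrightarrow> \<exists>k\<in>I. A i \<subseteq> A k \<and> A j \<subseteq> A k"
  shows "hull_step N (\<Union>i\<in>I. A i) \<subseteq> (\<Union>i\<in>I. hull_step N (A i))"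
proof
  fix x assume "x \<in> hull_step N (\<Union>i\<in>I. A i)"
  then consider "x \<in> (\<Union>i\<in>I. A i)"
    | p n xs where "x \<in> N" "set xs \<subseteq> (\<Union>i\<in>I. A i)" "x = skolem N p n xs"
    unfolding hull_step_def by blast
  then show "x \<in> (\<Union>i\<in>I. hull_step N (A i))"
  proof cases
    case 1
    then show ?thesis by (auto simp: hull_step_def)
  next
    case 2
    then obtain i where "i \<in> I" "set xs \<subseteq> A i"
      using directed_finite_subset[OF assms, where Y = "set xs"] by auto
    then show ?thesis using 2 by (auto simp: hull_step_def)
  qed
qed

text \<open>Skolem functions have finitely many arguments, so the hull of a directed union is the union of the
  hulls. This makes closure under the hull a club condition.\<close>

lemma hull_directed_UN:
  assumes "I \<noteq> {}" "\<And>i j. i \<in> I \<Longrightarrow> j \<in> I \<Longrightarrow> \<exists>k\<in>I. A i \<subseteq> A k \<and> A j \<subseteq> A k"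
  shows "hull N (\<Union>i\<in>I. A i) \<subseteq> (\<Union>i\<in>I. hull N (A i))"
proof -
  have mono: "(hull_step N ^^ k) B \<subseteq> (hull_step N ^^ k) B'" if "B \<subseteq> B'" for k B B'
    by (induction k) (use that in \<open>simp_all add: hull_step_mono\<close>)
  have "(hull_step N ^^ k) (\<Union>i\<in>I. A i) \<subseteq> (\<Union>i\<in>I. (hull_step N ^^ k) (A i))" for k
  proof (induction k)
    case (Suc k)
    have "(hull_step N ^^ Suc k) (\<Union>i\<in>I. A i) \<subseteq> hull_step N (\<Union>i\<in>I. (hull_step N ^^ k) (A i))"
      using hull_step_mono[OF Suc] by simp
    also have "\<dots> \<subseteq> (\<Union>i\<in>I. hull_step N ((hull_step N ^^ k) (A i)))"
      by (rule hull_step_directed_UN[OF assms(1)]) (use assms(2) mono in meson)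
    finally show ?case by simp
  qed simp
  then show ?thesis unfolding hull_def by blast
qed

lemma hull_closed: "hull_step N (hull N A) \<subseteq> hull N A"
proof -
  have inc: "(hull_step N ^^ k) A \<subseteq> (hull_step N ^^ (m + k)) A" for k m
    by (induction m) (auto simp: hull_step_def)
  have "hull_step N (hull N A) \<subseteq> (\<Union>k. hull_step N ((hull_step N ^^ k) A))"
    unfolding hull_def
  proof (rule hull_step_directed_UN)
    fix i j :: nat
    show "\<exists>k\<in>UNIV. (hull_step N ^^ i) A \<subseteq> (hull_step N ^^ k) A \<and>
        (hull_step N ^^ j) A \<subseteq> (hull_step N ^^ k) A"
      using inc[of i j] inc[of j i] by (intro bexI[of _ "i + j"]) (simp_all add: add.commute)
  qed simp
  also have "\<dots> = (\<Union>k. (hull_step N ^^ Suc k) A)" by simp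
  also have "\<dots> \<subseteq> hull N A" unfolding hull_def by blast
  finally show ?thesis .
qed

text \<open>The criterion of Tarski and Vaught.\<close>

lemma hull_elementary:
  assumes A: "A \<subseteq> N" and s: "range s \<subseteq> hull N A"
  shows "sat (hull N A) p s \<longleftrightarrow> sat N p s"
  using s
proof (induction p arbitrary: s)
  case (Ex n p)
  have IH: "sat (hull N A) p (s(n := x)) \<longleftrightarrow> sat N p (s(n := x))" if "x \<in> hull N A" for x
    using that Ex.prems by (intro Ex.IH) auto
  have "\<exists>x\<in>hull N A. sat N p (s(n := x))" if ex: "\<exists>x\<in>N. sat N p (s(n := x))"
  proof -
    \<comment> \<open>The list is long enough for no variable of \<open>p\<close> to be looked up beyond its end.\<close>
    define xs where "xs = map s [0..<var_bound p]"
    have eq: "sat N p ((\<lambda>i. xs ! i)(n := x)) \<longleftrightarrow> sat N p (s(n := x))" for x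
      by (rule sat_cong) (simp add: xs_def)
    have sk: "skolem N p n xs \<in> N \<and> sat N p ((\<lambda>i. xs ! i)(n := skolem N p n xs))"
      unfolding skolem_def by (rule someI_ex) (use ex eq in auto)
    moreover have "set xs \<subseteq> hull N A" using Ex.prems by (auto simp: xs_def)
    ultimately have "skolem N p n xs \<in> hull N A"
      using hull_closed[of N A] unfolding hull_step_def by blast
    then show ?thesis using sk eq by blast
  qed
  then show ?case using IH hull_subset[OF A] by auto
qed auto

lemma hull_lesspoll:
  assumes reg: "regular_cardinal \<kappa>" "uncountable (elts \<kappa>)" and A: "A \<prec> elts \<kappa>"
  shows "hull N A \<prec> elts \<kappa>"
proof -
  have \<kappa>: "Card \<kappa>" "infinite (elts \<kappa>)" using reg by (auto simp: regular_cardinal_def)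
  have step: "hull_step N B \<prec> elts \<kappa>" if B: "B \<prec> elts \<kappa>" for B
  proof -
    have small: "(UNIV :: (fm \<times> nat) set) \<times> lists B \<prec> elts \<kappa>"
      by (intro lesspoll_Times[OF \<kappa>] regular_lists[OF reg B] countable_lesspoll_uncountable reg(2))
        simp
    have "{x \<in> N. \<exists>p n xs. set xs \<subseteq> B \<and> x = skolem N p n xs}
        \<subseteq> (\<lambda>((p, n), xs). skolem N p n xs) ` ((UNIV :: (fm \<times> nat) set) \<times> lists B)"
    proof
      fix x assume "x \<in> {x \<in> N. \<exists>p n xs. set xs \<subseteq> B \<and> x = skolem N p n xs}"
      then obtain p n xs where "set xs \<subseteq> B" "x = skolem N p n xs" by blast
      then show "x \<in> (\<lambda>((p, n), xs). skolem N p n xs) ` ((UNIV :: (fm \<times> nat) set) \<times> lists B)"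
        by (intro image_eqI[of _ _ "((p, n), xs)"]) auto
    qed
    then have "{x \<in> N. \<exists>p n xs. set xs \<subseteq> B \<and> x = skolem N p n xs} \<prec> elts \<kappa>"
      by (rule lesspoll_trans1[OF subset_image_lepoll small])
    then show ?thesis unfolding hull_step_def by (rule regular_Un[OF reg(1) B])
  qed
  have "(hull_step N ^^ k) A \<prec> elts \<kappa>" for k
    by (induction k) (use A step in auto)
  then show ?thesis unfolding hull_def by (rule regular_UN_nat[OF reg])
qed


section \<open>Collapsing an elementary substructure\<close>

lemma sat_iso:
  assumes "inj_on \<pi> X" "\<And>x y. x \<in> X \<Longrightarrow> y \<in> X \<Longrightarrow> \<pi> x \<in> elts (\<pi> y) \<longleftrightarrow> x \<in> elts y"
    and "range s \<subseteq> X"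
  shows "sat (\<pi> ` X) p (\<pi> \<circ> s) \<longleftrightarrow> sat X p s"
  using assms(3)
proof (induction p arbitrary: s)
  case (Mem m n)
  then show ?case using assms(2)[of "s m" "s n"] by auto
next
  case (Eq m n)
  then have "s m \<in> X" "s n \<in> X" by auto
  then show ?case using inj_on_eq_iff[OF assms(1)] by simp
next
  case (Ex n p)
  have "sat (\<pi> ` X) p ((\<pi> \<circ> s)(n := \<pi> x)) \<longleftrightarrow> sat X p (s(n := x))" if "x \<in> X" for x
  proof -
    have "(\<pi> \<circ> s)(n := \<pi> x) = \<pi> \<circ> s(n := x)" by (simp add: fun_upd_comp)
    moreover have "range (s(n := x)) \<subseteq> X" using Ex.prems that by auto
    ultimately show ?thesis using Ex.IH by metis
  qed
  then show ?case unfolding sat.simps by blast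
qed auto

text \<open>The inverse of the collapse is an isomorphism onto \<open>X\<close>, which is elementary in \<open>N\<close>. Extensionality
  of \<open>X\<close>, which makes the collapse injective, comes from the transitivity of \<open>N\<close>: elementarity puts
  into \<open>X\<close> an element that distinguishes two different sets.\<close>

lemma collapse_elementary:
  fixes X N :: "'v::zfc_universe set"
  assumes sub: "X \<subseteq> N" and N: "transitive_class N"
    and elem: "\<And>p s. range s \<subseteq> X \<Longrightarrow> sat X p s \<longleftrightarrow> sat N p s"
  shows "inj_on (collapse X) X"
    and "elementary_embedding (collapse X ` X) N (inv_into X (collapse X))"
proof -
  show inj: "inj_on (collapse X) X"
  proof (rule collapse_inj, rule ccontr)
    fix x y assume xy: "x \<in> X" "y \<in> X" "elts x \<inter> X = elts y \<inter> X" "x \<noteq> y"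
    let ?p = "Ex 2 (Neg (fIff (Mem 2 0) (Mem 2 1)))" and ?s = "(\<lambda>_. x)(1 := y)"
    obtain z where "z \<in> elts x \<and> z \<notin> elts y \<or> z \<in> elts y \<and> z \<notin> elts x"
      using xy(4) extensionality by blast
    moreover from this have "z \<in> N" using xy(1,2) sub N transitive_classD by blast
    ultimately have "sat N ?p ?s" by auto
    then have "sat X ?p ?s" using elem[of ?s ?p] xy(1,2) by auto
    then show False using xy(3) by auto
  qed
  let ?j = "inv_into X (collapse X)"
  have "sat (collapse X ` X) p s \<longleftrightarrow> sat N p (?j \<circ> s)" if s: "range s \<subseteq> collapse X ` X" for p s
  proof -
    have mem: "s i \<in> collapse X ` X" for i using s by blast
    have js: "range (?j \<circ> s) \<subseteq> X" using inv_into_into[OF mem] by auto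
    have "collapse X \<circ> (?j \<circ> s) = s" using f_inv_into_f[OF mem] by (simp add: fun_eq_iff)
    then show ?thesis
      using sat_iso[OF inj collapse_mem_iff[OF inj] js, of p] elem[OF js, of p] by simp
  qed
  then show "elementary_embedding (collapse X ` X) N ?j"
    unfolding elementary_embedding_def using sub inj by auto
qed


section \<open>From ineffability to small embeddings\<close>

text \<open>The first condition holds exactly if \<open>a\<close> is the trace on \<open>lam\<close> of the hull generated by \<open>a\<close> and the
  parameters \<open>P\<close>; the second one will make \<open>a \<inter> \<kappa>\<close> an ordinal. Both survive unions of chains. An
  unbounded supply is obtained by closing off \<open>\<omega>\<close> times; each round keeps the size below
  \<open>\<kappa>\<close> by regularity, and so does the union by uncountability.\<close>

lemma club_hull_fixed:
  fixes \<kappa> lam :: "'v::zfc_universe"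
  assumes reg: "regular_cardinal \<kappa>" "uncountable (elts \<kappa>)" and P: "countable P"
  shows "club_Pk \<kappa> lam {a \<in> Pk \<kappa> lam. hull N (elts a \<union> P) \<inter> elts lam \<subseteq> elts a \<and>
    (\<forall>\<xi>\<in>elts a \<inter> elts \<kappa>. elts \<xi> \<inter> elts lam \<subseteq> elts a)}" (is "club_Pk \<kappa> lam ?C")
proof -
  have \<kappa>: "Card \<kappa>" "infinite (elts \<kappa>)" using reg by (auto simp: regular_cardinal_def)
  define h where "h a = hull N (a \<union> P)" for a
  have h_small: "h a \<prec> elts \<kappa>" if "a \<prec> elts \<kappa>" for a
    unfolding h_def
    by (intro hull_lesspoll[OF reg] regular_Un[OF reg(1)] that
        countable_lesspoll_uncountable[OF P reg(2)])
  have h_UN: "h (\<Union>i\<in>I. A i) \<subseteq> (\<Union>i\<in>I. h (A i))"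
    if "I \<noteq> {}" "\<And>i j. i \<in> I \<Longrightarrow> j \<in> I \<Longrightarrow> A i \<subseteq> A j \<or> A j \<subseteq> A i" for I and A :: "'i \<Rightarrow> 'v set"
  proof -
    have "(\<Union>i\<in>I. A i) \<union> P = (\<Union>i\<in>I. A i \<union> P)" using that(1) by auto
    moreover have "\<exists>k\<in>I. A i \<union> P \<subseteq> A k \<union> P \<and> A j \<union> P \<subseteq> A k \<union> P" if "i \<in> I" "j \<in> I" for i j
      using \<open>\<And>i j. i \<in> I \<Longrightarrow> j \<in> I \<Longrightarrow> A i \<subseteq> A j \<or> A j \<subseteq> A i\<close>[OF that] that by blast
    ultimately show ?thesis
      unfolding h_def using hull_directed_UN[OF that(1), of "\<lambda>i. A i \<union> P"] by simp
  qed
  have C: "?C = {a \<in> Pk \<kappa> lam. h (elts a) \<inter> elts lam \<subseteq> elts a \<and>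
      (\<forall>\<xi>\<in>elts a \<inter> elts \<kappa>. elts \<xi> \<inter> elts lam \<subseteq> elts a)}"
    by (simp add: h_def)
  have "unbounded_Pk \<kappa> lam ?C"
    unfolding unbounded_Pk_def
  proof
    fix a assume a: "a \<in> Pk \<kappa> lam"
    \<comment> \<open>One round of closing off under both conditions.\<close>
    define G where "G B = B \<union> (h B \<inter> elts lam) \<union> (\<Union>\<xi>\<in>B \<inter> elts \<kappa>. elts \<xi> \<inter> elts lam)" for B
    define A where "A n = (G ^^ n) (elts a)" for n
    have A_Suc: "A (Suc n) = G (A n)" for n by (simp add: A_def)
    have G_small: "G B \<prec> elts \<kappa>" if "B \<prec> elts \<kappa>" for B
      unfolding G_def
    proof (intro regular_Un[OF reg(1)] regular_UN[OF reg(1)] that)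
      show "h B \<inter> elts lam \<prec> elts \<kappa>"
        by (rule lesspoll_trans1[OF subset_imp_lepoll h_small[OF that]]) auto
      show "B \<inter> elts \<kappa> \<prec> elts \<kappa>"
        by (rule lesspoll_trans1[OF subset_imp_lepoll that]) auto
      show "elts \<xi> \<inter> elts lam \<prec> elts \<kappa>" if "\<xi> \<in> B \<inter> elts \<kappa>" for \<xi>
        by (rule lesspoll_trans1[OF subset_imp_lepoll Card_lesspoll[OF \<kappa>(1)]]) (use that in auto)
    qed
    have A: "A n \<prec> elts \<kappa> \<and> A n \<subseteq> elts lam" for n
    proof (induction n)
      case 0
      then show ?case using a by (simp add: A_def Pk_def)
    next
      case (Suc n)
      then show ?case unfolding A_Suc using G_small by (auto simp: G_def)
    qed
    have inc: "A m \<subseteq> A n" if "m \<le> n" for m n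
      by (rule lift_Suc_mono_le[OF _ that]) (unfold A_Suc, auto simp: G_def)
    define c where "c = vset (\<Union>n. A n)"
    have "(\<Union>n. A n) \<subseteq> elts lam" using A by blast
    then have elts_c: "elts c = (\<Union>n. A n)"
      unfolding c_def by (intro elts_vset) (rule small_subset[OF small_elts])
    have "c \<in> Pk \<kappa> lam"
      using A regular_UN_nat[OF reg, of A] by (auto simp: Pk_def elts_c)
    moreover have "h (elts c) \<inter> elts lam \<subseteq> elts c"
    proof -
      have "h (elts c) \<subseteq> (\<Union>n. h (A n))"
        unfolding elts_c
      proof (rule h_UN)
        show "A m \<subseteq> A n \<or> A n \<subseteq> A m" for m n
          using inc[of m n] inc[of n m] by linarith
      qed simp
      moreover have "h (A n) \<inter> elts lam \<subseteq> A (Suc n)" for n by (auto simp: A_Suc G_def)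
      ultimately show ?thesis unfolding elts_c by blast
    qed
    moreover have "elts \<xi> \<inter> elts lam \<subseteq> elts c" if mem: "\<xi> \<in> elts c \<inter> elts \<kappa>" for \<xi>
    proof -
      obtain n where "\<xi> \<in> A n" using mem unfolding elts_c by blast
      then have "elts \<xi> \<inter> elts lam \<subseteq> A (Suc n)" using that by (auto simp: A_Suc G_def)
      then show ?thesis unfolding elts_c by blast
    qed
    moreover have "elts a \<subseteq> elts c"
      unfolding elts_c using UN_upper[of 0 UNIV A] by (simp add: A_def)
    ultimately show "\<exists>c\<in>?C. elts a \<subseteq> elts c" unfolding C by blast
  qed
  moreover have "closed_Pk \<kappa> ?C"
    unfolding closed_Pk_def
  proof (intro ballI allI impI)
    fix \<beta> :: 'v and x :: "'v \<Rightarrow> 'v"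
    assume \<beta>: "\<beta> \<in> elts \<kappa>" and *: "elts \<beta> \<noteq> {} \<and> x ` elts \<beta> \<subseteq> ?C \<and>
      (\<forall>\<eta>\<in>elts \<beta>. \<forall>\<xi>\<in>elts \<eta>. elts (x \<xi>) \<subseteq> elts (x \<eta>))"
    have x: "x \<xi> \<in> Pk \<kappa> lam" "h (elts (x \<xi>)) \<inter> elts lam \<subseteq> elts (x \<xi>)"
      "\<And>\<zeta>. \<zeta> \<in> elts (x \<xi>) \<Longrightarrow> \<zeta> \<in> elts \<kappa> \<Longrightarrow> elts \<zeta> \<inter> elts lam \<subseteq> elts (x \<xi>)"
      if "\<xi> \<in> elts \<beta>" for \<xi>
      using * that unfolding C by blast+
    define c where "c = vset (\<Union>\<xi>\<in>elts \<beta>. elts (x \<xi>))"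
    have elts_c: "elts c = (\<Union>\<xi>\<in>elts \<beta>. elts (x \<xi>))"
      unfolding c_def by (intro elts_vset small_UN) auto
    have chain: "elts (x \<xi>) \<subseteq> elts (x \<eta>) \<or> elts (x \<eta>) \<subseteq> elts (x \<xi>)"
      if "\<xi> \<in> elts \<beta>" "\<eta> \<in> elts \<beta>" for \<xi> \<eta>
    proof -
      have "Ord \<beta>" using Ord_mem[OF Card_Ord[OF \<kappa>(1)] \<beta>] .
      then have "\<xi> \<in> elts \<eta> \<or> \<xi> = \<eta> \<or> \<eta> \<in> elts \<xi>"
        using Ord_linear[OF Ord_mem Ord_mem] that by blast
      moreover have "elts (x \<xi>) \<subseteq> elts (x \<eta>)" if "\<eta> \<in> elts \<beta>" "\<xi> \<in> elts \<eta>" for \<xi> \<eta>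
        using * that by simp
      ultimately show ?thesis using that by auto
    qed
    have "elts c \<prec> elts \<kappa>"
      unfolding elts_c
      by (intro regular_UN[OF reg(1)] Card_lesspoll[OF \<kappa>(1) \<beta>]) (use x(1) in \<open>simp add: Pk_def\<close>)
    moreover have "elts c \<subseteq> elts lam" using x(1) by (auto simp: elts_c Pk_def)
    moreover have "h (elts c) \<inter> elts lam \<subseteq> elts c"
    proof -
      have "h (elts c) \<subseteq> (\<Union>\<xi>\<in>elts \<beta>. h (elts (x \<xi>)))"
        unfolding elts_c
      proof (rule h_UN)
        show "elts \<beta> \<noteq> {}" using * by blast
      qed (rule chain)
      then show ?thesis using x(2) unfolding elts_c by blast
    qed
    moreover have "elts \<zeta> \<inter> elts lam \<subseteq> elts c" if "\<zeta> \<in> elts c \<inter> elts \<kappa>" for \<zeta>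
      using that x(3) unfolding elts_c by blast
    ultimately have "c \<in> ?C" unfolding C by (simp add: Pk_def)
    then show "vset (\<Union>\<xi>\<in>elts \<beta>. elts (x \<xi>)) \<in> ?C" by (simp only: c_def)
  qed
  ultimately show ?thesis by (auto simp: club_Pk_def)
qed

text \<open>Let \<open>D\<close> witness ineffability for \<open>d\<close>. The stationary set of all \<open>a\<close> with \<open>d a = D \<inter> a\<close> meets the
  club of \<open>club_hull_fixed\<close> for \<open>H \<theta>\<close> and the parameters \<open>\<kappa>\<close>, \<open>lam\<close>, \<open>D\<close> and the graph of \<open>d\<close>.
  For an \<open>a\<close> in both, the hull \<open>X\<close> has trace \<open>a\<close> on \<open>lam\<close> and size below \<open>\<kappa>\<close>; \<open>j\<close> is the
  inverse of its collapse \<open>\<pi>\<close>. The critical point is \<open>\<pi> \<kappa> = a \<inter> \<kappa>\<close>, and with \<open>\<delta> = \<pi> lam\<close> the set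
  \<open>j[\<delta>]\<close> is \<open>a\<close>. The preimage of \<open>d a = D \<inter> a\<close> under \<open>j\<close> is \<open>\<pi> D\<close>, an element of \<open>M\<close>.\<close>

lemma ineffable_imp_embedding:
  fixes \<kappa> lam :: "'v::zfc_universe"
  assumes ineff: "ineffable \<kappa> lam" and \<theta>: "Card \<theta>" "\<kappa> \<in> elts \<theta>" "elts (pow3 lam) \<prec> elts \<theta>"
    and d: "is_list (Pk \<kappa> lam) d"
  shows "\<exists>M j \<delta>. small_embedding \<kappa> \<theta> M j \<and> \<delta> \<in> elts M \<inter> elts \<kappa> \<and> j \<delta> = lam \<and>
    fun_graph (Pk \<kappa> lam) d \<in> j ` elts M \<and>
    vset (j -` elts (d (vset (j ` elts \<delta>))) \<inter> elts M) \<in> elts M"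
proof -
  have reg: "regular_cardinal \<kappa>" "uncountable (elts \<kappa>)" and lam: "Ord lam" "elts \<kappa> \<subseteq> elts lam"
    using ineff by (auto simp: ineffable_def Card_Ord)
  have \<kappa>: "Card \<kappa>" "Ord \<kappa>" using reg by (auto simp: regular_cardinal_def Card_Ord)
  obtain D where D: "elts D \<subseteq> elts lam"
    and stat: "stationary_Pk \<kappa> lam {a \<in> Pk \<kappa> lam. elts (d a) = elts D \<inter> elts a}"
    using ineff[unfolded ineffable_def, THEN conjunct2, THEN conjunct2, THEN conjunct2,
        THEN conjunct2, rule_format, OF d] by (elim exE conjE)
  define g where "g = fun_graph (Pk \<kappa> lam) d"
  define P where "P = {\<kappa>, lam, D, g}"
  have lamH: "lam \<in> H \<theta>"
    by (rule subset_transitive_in_H[OF pow3_transitive[OF lam(1)] \<theta>(3) Ord_subset_pow3[OF lam(1)]])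
  have PH: "P \<subseteq> H \<theta>"
    using lamH H_subset_closed[OF lamH] D lam(2) fun_graph_list_in_H[OF lam(1) \<theta>(3) d]
    by (auto simp: P_def g_def)
  obtain a where a: "a \<in> Pk \<kappa> lam" "elts (d a) = elts D \<inter> elts a"
    "hull (H \<theta>) (elts a \<union> P) \<inter> elts lam \<subseteq> elts a"
    "\<And>\<xi>. \<xi> \<in> elts a \<Longrightarrow> \<xi> \<in> elts \<kappa> \<Longrightarrow> elts \<xi> \<inter> elts lam \<subseteq> elts a"
    using stat club_hull_fixed[OF reg, of P lam "H \<theta>"] unfolding stationary_Pk_def P_def
    by fastforce
  define X where "X = hull (H \<theta>) (elts a \<union> P)"
  have aX: "elts a \<union> P \<subseteq> X" unfolding X_def by (rule subset_hull)
  have a_lam: "elts a \<subseteq> elts lam" and a_small: "elts a \<prec> elts \<kappa>" using a(1) by (auto simp: Pk_def)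
  have lamX: "elts lam \<inter> X = elts a" using a(3) aX a_lam unfolding X_def by blast
  have aH: "elts a \<union> P \<subseteq> H \<theta>"
    using PH a_lam transitive_classD[OF transitive_class_H lamH] by blast
  have XH: "X \<subseteq> H \<theta>" unfolding X_def by (rule hull_subset[OF aH])
  have "P \<prec> elts \<kappa>"
    using reg(2) by (intro countable_lesspoll_uncountable) (auto simp: P_def)
  then have X_small: "X \<prec> elts \<kappa>"
    unfolding X_def by (intro hull_lesspoll[OF reg] regular_Un[OF reg(1)] a_small)
  define \<pi> where "\<pi> = collapse X"
  define M where "M = vset (\<pi> ` X)"
  define j where "j = inv_into X \<pi>"
  have "small X" using small_lepoll[OF small_elts lesspoll_imp_lepoll[OF X_small]] .
  then have elts_M: "elts M = \<pi> ` X" by (simp add: M_def)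
  have elem: "sat X p s \<longleftrightarrow> sat (H \<theta>) p s" if "range s \<subseteq> X" for p s
    unfolding X_def by (rule hull_elementary[OF aH]) (use that X_def in simp)
  have inj: "inj_on \<pi> X" and emb: "elementary_embedding (elts M) (H \<theta>) j"
    unfolding \<pi>_def elts_M j_def by (rule collapse_elementary[OF XH transitive_class_H elem]; simp)+
  have transM: "transitive_class (elts M)" unfolding elts_M \<pi>_def by (rule transitive_collapse)
  interpret elementary "elts M" "H \<theta>" j
    using emb transM transitive_class_H by unfold_locales
  have j_pi: "j (\<pi> x) = x" if "x \<in> X" for x unfolding j_def using inj that by (rule inv_into_f_f)
  have pi_M: "\<pi> x \<in> elts M" if "x \<in> X" for x using that by (simp add: elts_M)
  have elts_pi: "elts (\<pi> x) = \<pi> ` (elts x \<inter> X)" for x unfolding \<pi>_def by (rule elts_collapse)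
  have M_small: "elts M \<prec> elts \<kappa>" unfolding elts_M using image_lepoll X_small by (rule lesspoll_trans1)
  define \<mu> where "\<mu> = vset (elts a \<inter> elts \<kappa>)"
  have "small (elts a \<inter> elts \<kappa>)" by (rule small_subset[OF small_elts]) auto
  then have elts_mu: "elts \<mu> = elts a \<inter> elts \<kappa>" by (simp add: \<mu>_def)
  have mu_trans: "transitive_class (elts \<mu>)"
    unfolding transitive_class_def elts_mu
    using a(4) Ord_subset[OF \<kappa>(2)] lam(2) by fastforce
  then have Ord_mu: "Ord \<mu>" using elts_mu Ord_mem[OF \<kappa>(2)] by (auto simp: Ord_def)
  have "elts \<mu> \<prec> elts \<kappa>"
    by (rule lesspoll_trans1[OF subset_imp_lepoll a_small]) (auto simp: elts_mu)
  then have mu: "\<mu> \<in> elts \<kappa>" using Ord_lesspoll_mem Ord_mu \<kappa>(2) by blast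
  have pi_fix: "\<pi> \<xi> = \<xi>" "\<xi> \<in> X" if "\<xi> \<in> elts \<mu>" for \<xi>
  proof -
    show "\<xi> \<in> X" using that aX elts_mu by blast
    show "\<pi> \<xi> = \<xi>" unfolding \<pi>_def
      by (rule collapse_ident_transitive[OF mu_trans _ that]) (use aX elts_mu in blast)
  qed
  have "elts (\<pi> \<kappa>) = elts \<mu>"
  proof -
    have "elts \<kappa> \<inter> X = elts \<mu>" using lamX lam(2) elts_mu by blast
    then show ?thesis using pi_fix(1) by (simp add: elts_pi)
  qed
  then have pi_kappa: "\<pi> \<kappa> = \<mu>" by (rule extensionality)
  have PX: "\<kappa> \<in> X" "lam \<in> X" "D \<in> X" "g \<in> X" using aX by (auto simp: P_def)
  have j_mu: "j \<mu> = \<kappa>" "\<mu> \<in> elts M" using j_pi[OF PX(1)] pi_M[OF PX(1)] pi_kappa by auto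
  have mu_least: "elts \<mu> \<subseteq> elts \<beta>" if "Ord \<beta>" "\<beta> \<in> elts (j \<beta>)" for \<beta>
  proof (rule ccontr)
    assume "\<not> elts \<mu> \<subseteq> elts \<beta>"
    then have "\<beta> \<in> elts \<mu>" using Ord_not_mem_iff[OF Ord_mu that(1)] by blast
    then have "j \<beta> = \<beta>" using pi_fix[of \<beta>] j_pi[of \<beta>] by simp
    then show False using that(2) by simp
  qed
  have "crit (elts M) j = \<mu>"
    by (rule crit_eqI) (use j_mu Ord_mu mu mu_least in auto)
  moreover have "nontrivial (elts M) j"
    unfolding nontrivial_def using j_mu Ord_mu mu by (intro bexI[of _ \<mu>]) simp_all
  moreover have "M \<in> H \<theta>"
    using subset_transitive_in_H[OF transM lesspoll_trans[OF M_small Card_lesspoll[OF \<theta>(1,2)]]]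
    by simp
  ultimately have small_emb: "small_embedding \<kappa> \<theta> M j"
    using \<kappa> \<theta> transM emb j_mu by (simp add: small_embedding_def)
  define \<delta> where "\<delta> = \<pi> lam"
  have \<delta>: "\<delta> \<in> elts M" "j \<delta> = lam" using pi_M[OF PX(2)] j_pi[OF PX(2)] by (auto simp: \<delta>_def)
  have elts_\<delta>: "elts \<delta> = \<pi> ` elts a" by (simp add: \<delta>_def elts_pi lamX)
  have "Ord \<delta>" using j_Ord[OF \<delta>(1)] \<delta>(2) lam(1) by simp
  moreover have "elts \<delta> \<prec> elts \<kappa>"
    unfolding elts_\<delta> using image_lepoll a_small by (rule lesspoll_trans1)
  ultimately have \<delta>\<kappa>: "\<delta> \<in> elts \<kappa>" using Ord_lesspoll_mem \<kappa>(2) by blast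
  have "j ` elts \<delta> = elts a"
    unfolding elts_\<delta> image_image using j_pi aX by (force simp: image_iff)
  then have a_eq: "vset (j ` elts \<delta>) = a" by simp
  have "j -` elts (d a) \<inter> elts M = elts (\<pi> D)"
  proof
    show "j -` elts (d a) \<inter> elts M \<subseteq> elts (\<pi> D)"
    proof
      fix m assume m: "m \<in> j -` elts (d a) \<inter> elts M"
      then obtain x where x: "x \<in> X" "m = \<pi> x" using elts_M by blast
      then have "x \<in> elts D" using m a(2) j_pi by simp
      then show "m \<in> elts (\<pi> D)" unfolding elts_pi using x by blast
    qed
    show "elts (\<pi> D) \<subseteq> j -` elts (d a) \<inter> elts M"
    proof
      fix m assume "m \<in> elts (\<pi> D)"
      then obtain x where x: "x \<in> elts D" "x \<in> X" "m = \<pi> x" unfolding elts_pi by blast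
      then have "x \<in> elts a" using D lamX by blast
      then show "m \<in> j -` elts (d a) \<inter> elts M" using x a(2) j_pi pi_M by simp
    qed
  qed
  then have "vset (j -` elts (d (vset (j ` elts \<delta>))) \<inter> elts M) \<in> elts M"
    using pi_M[OF PX(3)] by (simp add: a_eq)
  moreover have "fun_graph (Pk \<kappa> lam) d \<in> j ` elts M"
    using j_pi[OF PX(4)] pi_M[OF PX(4)] unfolding g_def by (metis imageI)
  ultimately show ?thesis using small_emb \<delta> \<delta>\<kappa> by blast
qed

theorem lemma5p8:
  fixes \<kappa> lam :: "'v::zfc_universe"
  assumes "Card \<kappa>" and "Card lam" and "elts \<kappa> \<subseteq> elts lam"
  shows "ineffable \<kappa> lam \<longleftrightarrow>
    (\<exists>\<alpha>. Ord \<alpha> \<and> elts \<kappa> \<subseteq> elts \<alpha> \<and>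
      (\<forall>\<theta>. Card \<theta> \<and> \<alpha> \<in> elts \<theta> \<longrightarrow>
        (\<forall>d. is_list (Pk \<kappa> lam) d \<longrightarrow>
          (\<exists>M j \<delta>. small_embedding \<kappa> \<theta> M j \<and>
             \<delta> \<in> elts M \<inter> elts \<kappa> \<and> j \<delta> = lam \<and>
             fun_graph (Pk \<kappa> lam) d \<in> j ` elts M \<and>
             vset (j -` elts (d (vset (j ` elts \<delta>))) \<inter> elts M) \<in> elts M))))"
    (is "_ \<longleftrightarrow> (\<exists>\<alpha>. ?large \<alpha>)")
proof
  have ord: "Ord \<kappa>" "Ord lam" using assms Card_Ord by blast+
  note lam_sub = Ord_subset_pow3[OF ord(2)]
  {
    assume ineff: "ineffable \<kappa> lam"
    obtain \<alpha> :: 'v where \<alpha>: "Card \<alpha>" "elts (pow3 lam) \<prec> elts \<alpha>" using larger_Card[OF small_elts] .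
    have "elts \<kappa> \<prec> elts \<alpha>"
      using lesspoll_trans1[OF subset_imp_lepoll \<alpha>(2)] assms(3) lam_sub by blast
    then have \<kappa>\<alpha>: "\<kappa> \<in> elts \<alpha>" using Ord_lesspoll_mem ord(1) Card_Ord[OF \<alpha>(1)] by blast
    have "?large \<alpha>"
    proof (intro conjI allI impI)
      show "Ord \<alpha>" "elts \<kappa> \<subseteq> elts \<alpha>" using Card_Ord[OF \<alpha>(1)] Ord_subset \<kappa>\<alpha> by blast+
      fix \<theta> d assume \<theta>: "Card \<theta> \<and> \<alpha> \<in> elts \<theta>" and d: "is_list (Pk \<kappa> lam) d"
      have "\<kappa> \<in> elts \<theta>" using \<theta> \<kappa>\<alpha> Card_Ord Ord_trans by blast
      moreover have "elts (pow3 lam) \<prec> elts \<theta>"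
        using lesspoll_trans[OF \<alpha>(2) Card_lesspoll] \<theta> by blast
      ultimately show "\<exists>M j \<delta>. small_embedding \<kappa> \<theta> M j \<and> \<delta> \<in> elts M \<inter> elts \<kappa> \<and> j \<delta> = lam \<and>
          fun_graph (Pk \<kappa> lam) d \<in> j ` elts M \<and>
          vset (j -` elts (d (vset (j ` elts \<delta>))) \<inter> elts M) \<in> elts M"
        using ineffable_imp_embedding[OF ineff _ _ _ d] \<theta> by blast
    qed
    then show "\<exists>\<alpha>. ?large \<alpha>" by (rule exI[where x = \<alpha>])
  next
    assume "\<exists>\<alpha>. ?large \<alpha>"
    then obtain \<alpha> where \<alpha>: "?large \<alpha>" ..
    note Ord_\<alpha> = \<alpha>[THEN conjunct1] and large = \<alpha>[THEN conjunct2, THEN conjunct2, rule_format]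
    \<comment> \<open>Large enough to compute clubs in \<open>P_\<kappa>(lam)\<close> correctly.\<close>
    obtain \<theta> :: 'v where \<theta>: "Card \<theta>" "elts (pow3 lam) \<union> elts \<alpha> \<prec> elts \<theta>"
      using larger_Card[OF small_Un[OF small_elts small_elts]] .
    have pow3: "elts (pow3 lam) \<prec> elts \<theta>" and "elts \<alpha> \<prec> elts \<theta>"
      by (rule lesspoll_trans1[OF subset_imp_lepoll \<theta>(2)]; simp)+
    then have \<alpha>\<theta>: "\<alpha> \<in> elts \<theta>" using Ord_lesspoll_mem[OF Ord_\<alpha> Card_Ord[OF \<theta>(1)]] by simp
    have emb: "\<exists>M j \<delta>. small_embedding \<kappa> \<theta> M j \<and> \<delta> \<in> elts M \<inter> elts \<kappa> \<and> j \<delta> = lam \<and>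
          fun_graph (Pk \<kappa> lam) d \<in> j ` elts M \<and>
          vset (j -` elts (d (vset (j ` elts \<delta>))) \<inter> elts M) \<in> elts M"
      if "is_list (Pk \<kappa> lam) d" for d
      using large[OF conjI[OF \<theta>(1) \<alpha>\<theta>] that] .
    \<comment> \<open>Any list yields an embedding, which is enough for the regularity of \<open>\<kappa>\<close>.\<close>
    have "is_list (Pk \<kappa> lam) (\<lambda>a. a)" by (simp add: is_list_def)
    from emb[OF this] obtain M j where "small_embedding \<kappa> \<theta> M j" by blast
    then have reg: "regular_cardinal \<kappa> \<and> uncountable (elts \<kappa>)"
      by (rule critical_point_regular[OF assms(1) ord(2) assms(3) pow3])
    have "\<exists>D. elts D \<subseteq> elts lam \<and>
        stationary_Pk \<kappa> lam {a \<in> Pk \<kappa> lam. elts (d a) = elts D \<inter> elts a}"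
      if d: "is_list (Pk \<kappa> lam) d" for d
    proof -
      from emb[OF d] obtain M j \<delta> where
        *: "small_embedding \<kappa> \<theta> M j" "\<delta> \<in> elts M" "\<delta> \<in> elts \<kappa>" "j \<delta> = lam"
        "fun_graph (Pk \<kappa> lam) d \<in> j ` elts M"
        "vset (j -` elts (d (vset (j ` elts \<delta>))) \<inter> elts M) \<in> elts M" by blast
      show ?thesis
        by (rule exI, rule embedding_imp_stationary[OF _ ord(2) assms(3) pow3 d *]) (use reg in simp)
    qed
    then show "ineffable \<kappa> lam" using reg assms by (simp add: ineffable_def)
  }
qed

end
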